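(* For every integer $k\ge 3$, the set $$X_{\rho,k}:=\{\rho(G,S) : G=\langle S\rangle \text{ a finitely generated group},\ S=S^{-1},\ |S|=k\}$$ has no isolated points on the interval $[\alpha_k,1]$, where $\alpha_k:=\frac{2\sqrt{k-1}}{k}$.
   Context: All generating sets $S$ are finite and symmetric, $S=S^{-1}$. The spectral radius is $\rho(G,S):=\limsup_{n\to\infty}\frac1{|S|}\sqrt[n]{c(n)}$, where $c(n)$ is the number of words of length $n$ in the alphabet $S$ that equal the identity in $G$. (It is known that $X_{\rho,k}\subseteq[\alpha_k,1]$.) *)

theory Defs
  imports "HOL-Analysis.Analysis" "HOL-Algebra.Generated_Groups"
begin

definition identity_words :: "('a, 'b) monoid_scheme \<Rightarrow> 'a set \<Rightarrow> nat \<Rightarrow> 'a list set" where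
  "identity_words G S n =
     {w. set w \<subseteq> S \<and> length w = n \<and> foldr (\<otimes>\<^bsub>G\<^esub>) w \<one>\<^bsub>G\<^esub> = \<one>\<^bsub>G\<^esub>}"

(* The identity element is allowed to belong to S. *)
definition symmetric_generating_set :: "('a, 'b) monoid_scheme \<Rightarrow> 'a set \<Rightarrow> bool" where
  "symmetric_generating_set G S \<longleftrightarrow>
     finite S \<and> S \<subseteq> carrier G \<and> m_inv G ` S = S \<and> generate G S = carrier G"

(* Real-valued sequences have no limsup operator in the library, hence the passage through
   ereal; by ereal_spectral_radius below, no information is lost. *)
definition spectral_radius :: "('a, 'b) monoid_scheme \<Rightarrow> 'a set \<Rightarrow> real" where
  "spectral_radius G S =
     real_of_ereal (limsup (\<lambda>n.
       ereal (1 / real (card S) * root n (real (card (identity_words G S n))))))"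

(* A finitely generated group is countable, hence isomorphic to one whose carrier is a set of
   natural numbers; by spectral_radius_in_X_rho below, restricting to such groups
   loses no value of the spectral radius. *)
definition X_rho :: "nat \<Rightarrow> real set" where
  "X_rho k = {spectral_radius G S | (G :: nat monoid) S.
     group G \<and> symmetric_generating_set G S \<and> card S = k}"

definition alpha :: "nat \<Rightarrow> real" where
  "alpha k = 2 * sqrt (real k - 1) / real k"

lemma card_identity_words_le:
  assumes "finite S"
  shows "card (identity_words G S n) \<le> card S ^ n"
proof -
  have "identity_words G S n \<subseteq> {w. set w \<subseteq> S \<and> length w = n}"
    by (auto simp: identity_words_def)
  then show ?thesis
    using card_mono[OF finite_lists_length_eq[OF assms]] card_lists_length_eq[OF assms] by metis
qed

lemma ereal_spectral_radius:
  assumes "finite S"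
  shows "ereal (spectral_radius G S) =
     limsup (\<lambda>n. ereal (1 / real (card S) * root n (real (card (identity_words G S n)))))"
    (is "_ = limsup ?f")
proof -
  have upper: "?f n \<le> 1" for n
  proof (cases "n = 0 \<or> card S = 0")
    case False
    have "root n (real (card (identity_words G S n))) \<le> root n (real (card S) ^ n)"
      using card_identity_words_le[OF assms, of G n] False
      by (metis bot_nat_0.not_eq_extremum of_nat_le_iff of_nat_power real_root_le_iff)
    also have "\<dots> = real (card S)"
      using False by (simp add: real_root_power_cancel)
    finally show ?thesis using False by (simp add: field_simps)
  qed auto
  have "limsup ?f \<le> 1"
    by (rule Limsup_bounded) (rule always_eventually, use upper in blast)
  moreover have "0 \<le> limsup ?f"
  proof (rule le_Limsup)
    show "\<forall>\<^sub>F n in sequentially. 0 \<le> ?f n" by (rule always_eventually) (simp add: real_root_ge_zero)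
  qed simp
  ultimately show ?thesis
    unfolding spectral_radius_def by (cases "limsup ?f") auto
qed

lemma countable_generate:
  assumes "group G" "countable S" "S \<subseteq> carrier G"
  shows "countable (generate G S)"
proof -
  interpret group G by fact
  let ?T = "S \<union> m_inv G ` S"
  have T: "?T \<subseteq> carrier G" using assms(3) by auto
  have c: "foldr (\<otimes>\<^bsub>G\<^esub>) w \<one>\<^bsub>G\<^esub> \<in> carrier G" if "set w \<subseteq> ?T" for w
    using that T by (induction w) auto
  have mult: "foldr (\<otimes>\<^bsub>G\<^esub>) u \<one>\<^bsub>G\<^esub> \<otimes>\<^bsub>G\<^esub> foldr (\<otimes>\<^bsub>G\<^esub>) v \<one>\<^bsub>G\<^esub>
      = foldr (\<otimes>\<^bsub>G\<^esub>) (u @ v) \<one>\<^bsub>G\<^esub>"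
    if "set u \<subseteq> ?T" "set v \<subseteq> ?T" for u v
    using that(1)
  proof (induction u)
    case Nil
    show ?case using c[OF that(2)] by simp
  next
    case (Cons a u)
    then have "a \<in> carrier G" "set u \<subseteq> ?T" using T by auto
    then show ?case
      using Cons.IH m_assoc[OF _ c[of u] c[OF that(2)]] by simp
  qed
  have "g \<in> (\<lambda>w. foldr (\<otimes>\<^bsub>G\<^esub>) w \<one>\<^bsub>G\<^esub>) ` lists ?T" if "g \<in> generate G S" for g
    using that
  proof (induction rule: generate.induct)
    case one
    show ?case by (rule image_eqI[of _ _ "[]"]) auto
  next
    case (incl h)
    then show ?case using assms(3) by (intro image_eqI[of _ _ "[h]"]) auto
  next
    case (inv h)
    then show ?case using assms(3) by (intro image_eqI[of _ _ "[inv\<^bsub>G\<^esub> h]"]) auto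
  next
    case (eng h1 h2)
    then obtain u v where u: "u \<in> lists ?T" "h1 = foldr (\<otimes>\<^bsub>G\<^esub>) u \<one>\<^bsub>G\<^esub>"
      and v: "v \<in> lists ?T" "h2 = foldr (\<otimes>\<^bsub>G\<^esub>) v \<one>\<^bsub>G\<^esub>" by auto
    have "u @ v \<in> lists ?T" using u(1) v(1) by auto
    moreover have "h1 \<otimes>\<^bsub>G\<^esub> h2 = foldr (\<otimes>\<^bsub>G\<^esub>) (u @ v) \<one>\<^bsub>G\<^esub>"
      using mult[of u v] u v by (simp only: in_lists_conv_set subset_iff) blast
    ultimately show ?case
      by (rule image_eqI[rotated])
  qed
  then have "generate G S \<subseteq> (\<lambda>w. foldr (\<otimes>\<^bsub>G\<^esub>) w \<one>\<^bsub>G\<^esub>) ` lists ?T" by blast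
  moreover have "countable \<dots>"
    using assms(2) by (intro countable_image countable_lists) auto
  ultimately show ?thesis by (rule countable_subset)
qed

lemma card_identity_words_iso:
  assumes "group G" "group H" "\<phi> \<in> iso G H" "S \<subseteq> carrier G"
  shows "card (identity_words H (\<phi> ` S) n) = card (identity_words G S n)"
proof -
  interpret group_hom G H \<phi>
    using assms by (simp add: group_hom_def group_hom_axioms_def iso_def)
  have inj: "inj_on \<phi> (carrier G)" using assms(3) by (auto simp: iso_def bij_betw_def)
  have c: "foldr (\<otimes>\<^bsub>G\<^esub>) w \<one>\<^bsub>G\<^esub> \<in> carrier G" if "set w \<subseteq> S" for w
    using that assms(4) by (induction w) auto
  have m: "foldr (\<otimes>\<^bsub>H\<^esub>) (map \<phi> w) \<one>\<^bsub>H\<^esub> = \<phi> (foldr (\<otimes>\<^bsub>G\<^esub>) w \<one>\<^bsub>G\<^esub>)"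
    if "set w \<subseteq> S" for w
    using that
  proof (induction w)
    case (Cons a w)
    then show ?case using c[of w] assms(4) by auto
  qed simp
  have e: "foldr (\<otimes>\<^bsub>H\<^esub>) (map \<phi> w) \<one>\<^bsub>H\<^esub> = \<one>\<^bsub>H\<^esub> \<longleftrightarrow> foldr (\<otimes>\<^bsub>G\<^esub>) w \<one>\<^bsub>G\<^esub> = \<one>\<^bsub>G\<^esub>"
    if "set w \<subseteq> S" for w
    using m[OF that] c[OF that] inj inj_onD[OF inj, of _ "\<one>\<^bsub>G\<^esub>"] by auto
  have "identity_words H (\<phi> ` S) n = map \<phi> ` identity_words G S n"
  proof (intro equalityI subsetI)
    fix v assume v: "v \<in> identity_words H (\<phi> ` S) n"
    then have "v \<in> map \<phi> ` lists S"
      by (auto simp: identity_words_def simp flip: lists_image)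
    then obtain w where "set w \<subseteq> S" "v = map \<phi> w" by auto
    then show "v \<in> map \<phi> ` identity_words G S n"
      using v e[of w] by (auto simp: identity_words_def)
  next
    fix v assume "v \<in> map \<phi> ` identity_words G S n"
    then show "v \<in> identity_words H (\<phi> ` S) n"
      using e by (auto 4 3 simp: identity_words_def)
  qed
  moreover have "inj_on (map \<phi>) (identity_words G S n)"
  proof (rule inj_on_subset)
    show "inj_on (map \<phi>) (lists S)"
      using inj_on_subset[OF inj assms(4)] by (rule inj_on_map_lists)
  qed (auto simp: identity_words_def)
  ultimately show ?thesis by (simp add: card_image)
qed

lemma spectral_radius_in_X_rho:
  fixes G :: "('a, 'b) monoid_scheme"
  assumes "group G" "symmetric_generating_set G S" "card S = k"
  shows "spectral_radius G S \<in> X_rho k"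
proof -
  interpret group G by fact
  have S: "finite S" "S \<subseteq> carrier G" "m_inv G ` S = S" "generate G S = carrier G"
    using assms(2) by (auto simp: symmetric_generating_set_def)
  have "countable (carrier G)"
    using countable_generate[OF assms(1) _ S(2)] S(1,4) by (simp add: countable_finite)
  then obtain f :: "'a \<Rightarrow> nat" where f: "inj_on f (carrier G)"
    by (auto simp: countable_def)
  define g where "g = inv_into (carrier G) f"
  define H where "H = \<lparr>carrier = f ` carrier G,
    mult = (\<lambda>x y. f (g x \<otimes>\<^bsub>G\<^esub> g y)), one = f \<one>\<^bsub>G\<^esub>\<rparr>"
  have iso: "f \<in> iso G H"
    using f by (auto simp: iso_def hom_def bij_betw_def H_def g_def)
  have "group (H\<lparr>one := f \<one>\<^bsub>G\<^esub>\<rparr>)"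
    using iso by (rule iso_imp_img_group)
  then have H: "group H" by (simp add: H_def)
  have carrier: "f ` carrier G = carrier H" by (simp add: H_def)
  interpret f: group_hom G H f
    using iso H by (simp add: group_hom_def group_hom_axioms_def iso_def is_group)
  have "m_inv H ` f ` S = f ` m_inv G ` S"
    unfolding image_image using S(2) by (intro image_cong) auto
  moreover have "generate H (f ` S) = f ` generate G S"
    using f.generate_img[OF S(2)] by simp
  moreover have "f ` S \<subseteq> carrier H"
    using S(2) by auto
  ultimately have "symmetric_generating_set H (f ` S)"
    unfolding symmetric_generating_set_def using S carrier by (simp only: finite_imageI)
  moreover have card: "card (f ` S) = card S"
    using inj_on_subset[OF f S(2)] by (rule card_image)
  moreover have "spectral_radius H (f ` S) = spectral_radius G S"
    unfolding spectral_radius_def card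
    using card_identity_words_iso[OF assms(1) H iso S(2)] by simp
  ultimately show ?thesis
    unfolding X_rho_def using H assms(3) by (intro CollectI exI[of _ H] exI[of _ "f ` S"]) simp
qed

end

theory Submission
  imports Defs
begin

text \<open>Write \<open>R = k \<rho>\<close> for the growth rate of the number of closed words. Suppose that \<open>G\<close> is infinite and
  its Cayley graph contains a cycle. Put lamps with states in \<open>W = Z/2 * Z/2 * Z/2\<close> on three edges far
  apart, the \<open>j\<close>-th edge multiplying the state by the \<open>j\<close>-th generator when it is crossed. The
  permutations of \<open>G \<times> W\<close> given by the letters generate a cover of \<open>G\<close>. Short closed words see at
  most one lamp from any starting point, hence act as commuting involutions of the cover, and the
  pigeonhole principle shows that the growth rate of the cover is nearly \<open>R\<close>. On the other hand,
  the three translates of a cycle give closed words of \<open>G\<close> of a common length \<open>L\<close> that act on a fibre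
  like the generators of \<open>W\<close>; their sum has norm at most \<open>2 \<surd>2\<close> on the cover, and the growth rate
  \<open>R'\<close> of the cover satisfies \<open>R' ^ L \<le> R ^ L - (3 - 2 \<surd>2)\<close>. So \<open>\<rho>(G)\<close> is approximated strictly from
  below. If \<open>G\<close> is finite, then \<open>\<rho>(G) = 1\<close> and the integers take the place of \<open>G\<close>. If the Cayley graph
  of \<open>G\<close> is a tree, then \<open>\<rho>(G) = \<alpha>\<^sub>k\<close> is minimal, and it is approximated from above by free products
  \<open>Z/m * Z/2 * \<dots> * Z/2\<close>, whose spectral radius is bounded by an explicit supersolution; should such a
  free product attain \<open>\<alpha>\<^sub>k\<close>, the first case applies to it.\<close>

section \<open>Growth rates of identity words\<close>

text \<open>Why three lamps: the Cayley graph of \<open>W\<close> is the 3-regular tree, where the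
  sum of the generators has norm 2 sqrt 2 < 3. Two lamps would give the infinite dihedral group,
  which is amenable, and no drop. Why remote: a closed word of length n then moves each fibre by a
  power of a single involution, so the c(n)^m products of m such words yield at most 2^c(n)
  permutations, a bound independent of m. Why a cycle: a loop that crosses its lamp edge exactly
  once acts on the fibre as one generator of \<open>W\<close>. In a tree every closed walk crosses
  each edge an even number of times, so lamps have no effect there and the approximation has to come
  from above. Spectral theory is avoided. Norms are taken over finite pieces of fibres, and upper
  bounds come from positive supersolutions: through a Schur test in the cover, through the total
  weight of all endpoints in the tree of cycles. The drop is additive because the operator of all
  blocks of length L downstairs equals a weakened operator, which still dominates the cover, plus 3
  - 2 sqrt 2 times the identity.\<close>

lemma le_if_power_le_linear:
  fixes x y A B :: real
  assumes "0 \<le> y" and le: "\<And>n. x ^ n \<le> (A * real n + B) * y ^ n"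
  shows "x \<le> y"
proof (rule ccontr)
  assume "\<not> x \<le> y"
  then have xy: "y < x" by simp
  with assms(1) have "x > 0" by simp
  define q where "q = y / x"
  have q: "0 \<le> q" "q < 1" using xy assms(1) \<open>x > 0\<close> by (auto simp: q_def)
  have one: "1 \<le> A * (real n * q ^ n) + B * q ^ n" for n
  proof -
    have "1 = x ^ n / x ^ n" using \<open>x > 0\<close> by simp
    also have "\<dots> \<le> (A * real n + B) * y ^ n / x ^ n"
      using le[of n] \<open>x > 0\<close> by (intro divide_right_mono) auto
    also have "\<dots> = A * (real n * q ^ n) + B * q ^ n"
      by (simp add: q_def power_divide algebra_simps add_divide_distrib)
    finally show ?thesis .
  qed
  have "(\<lambda>n. real n * q ^ n) \<longlonglongrightarrow> 0"
    using q by (intro powser_times_n_limit_0) auto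
  moreover have "(\<lambda>n. q ^ n) \<longlonglongrightarrow> 0"
    using LIMSEQ_power_zero[of q] q by simp
  ultimately have "(\<lambda>n. A * (real n * q ^ n) + B * q ^ n) \<longlonglongrightarrow> A * 0 + B * 0"
    by (intro tendsto_add tendsto_mult_left)
  then have "1 \<le> A * 0 + B * (0::real)"
    using one by (intro LIMSEQ_le_const[of _ _ 1]) auto
  then show False by simp
qed

lemma le_if_power_le_const:
  fixes x y C :: real
  assumes "0 \<le> y" "\<And>n. x ^ n \<le> C * y ^ n"
  shows "x \<le> y"
  using le_if_power_le_linear[of y x 0 C] assms by simp

abbreviation word_val :: "('a, 'b) monoid_scheme \<Rightarrow> 'a list \<Rightarrow> 'a" where
  "word_val G w \<equiv> foldr (\<otimes>\<^bsub>G\<^esub>) w \<one>\<^bsub>G\<^esub>"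

context group
begin

lemma word_val_closed: "set w \<subseteq> carrier G \<Longrightarrow> word_val G w \<in> carrier G"
  by (induction w) auto

lemma word_val_append:
  "set u \<subseteq> carrier G \<Longrightarrow> set v \<subseteq> carrier G \<Longrightarrow> word_val G (u @ v) = word_val G u \<otimes> word_val G v"
  by (induction u) (auto simp: word_val_closed m_assoc)

lemma word_val_inverse:
  "set w \<subseteq> carrier G \<Longrightarrow> word_val G (map (m_inv G) (rev w)) = inv (word_val G w)"
proof (induction w)
  case (Cons a w)
  then have "set (map (m_inv G) (rev w)) \<subseteq> carrier G" "a \<in> carrier G" "set w \<subseteq> carrier G" by auto
  with Cons show ?case
    by (simp add: word_val_append word_val_closed inv_mult_group del: foldr_append)
qed simp

end

lemma finite_identity_words: "finite S \<Longrightarrow> finite (identity_words G S n)"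
  by (rule finite_subset[OF _ finite_lists_length_eq[of S n]]) (auto simp: identity_words_def)

locale marked_group = group G for G (structure) +
  fixes S
  assumes sgs: "symmetric_generating_set G S"
begin

lemma fin: "finite S" and sub: "S \<subseteq> carrier G" and gen: "generate G S = carrier G"
  and inv_S: "s \<in> S \<Longrightarrow> inv s \<in> S"
  using sgs unfolding symmetric_generating_set_def by auto

lemma word_closed: "set w \<subseteq> S \<Longrightarrow> word_val G w \<in> carrier G"
  using word_val_closed sub by blast

lemma word_append: "set u \<subseteq> S \<Longrightarrow> set v \<subseteq> S \<Longrightarrow> word_val G (u @ v) = word_val G u \<otimes> word_val G v"
  using word_val_append sub by blast

lemma word_inverse: "set w \<subseteq> S \<Longrightarrow> word_val G (map (m_inv G) (rev w)) = inv (word_val G w)"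
  using word_val_inverse sub by blast

lemma set_word_inverse: "set w \<subseteq> S \<Longrightarrow> set (map (m_inv G) (rev w)) \<subseteq> S"
  using inv_S by auto

lemma word_surj:
  assumes "g \<in> carrier G"
  shows "\<exists>w. set w \<subseteq> S \<and> word_val G w = g"
proof -
  have "g \<in> generate G S" using assms gen by simp
  then show ?thesis
  proof (induction rule: generate.induct)
    case one
    then show ?case by (intro exI[of _ "[]"]) simp
  next
    case (incl h)
    then show ?case using sub by (intro exI[of _ "[h]"]) auto
  next
    case (inv h)
    then show ?case using sub inv_S by (intro exI[of _ "[inv h]"]) auto
  next
    case (eng h1 h2)
    then obtain u v where "set u \<subseteq> S" "word_val G u = h1" "set v \<subseteq> S" "word_val G v = h2" by auto
    then show ?case by (intro exI[of _ "u @ v"]) (auto simp: word_append simp del: foldr_append)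
  qed
qed

lemma identity_words_mult:
  "card (identity_words G S m) * card (identity_words G S n) \<le> card (identity_words G S (m + n))"
proof -
  have "inj_on (\<lambda>(u, v). u @ v) (identity_words G S m \<times> identity_words G S n)"
    by (auto simp: inj_on_def identity_words_def)
  then have "card (identity_words G S m \<times> identity_words G S n)
      = card ((\<lambda>(u, v). u @ v) ` (identity_words G S m \<times> identity_words G S n))"
    by (simp add: card_image)
  also have "\<dots> \<le> card (identity_words G S (m + n))"
    by (intro card_mono finite_identity_words fin) (auto simp: identity_words_def word_append)
  finally show ?thesis by (simp add: card_cartesian_product)
qed

lemma identity_words_0: "card (identity_words G S 0) = 1"
proof -
  have "identity_words G S 0 = {[]}" by (auto simp: identity_words_def)
  then show ?thesis by simp
qed

lemma identity_words_power: "card (identity_words G S n) ^ j \<le> card (identity_words G S (n * j))"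
proof (induction j)
  case 0
  then show ?case using identity_words_0 by simp
next
  case (Suc j)
  have "card (identity_words G S n) ^ Suc j
      \<le> card (identity_words G S n) * card (identity_words G S (n * j))" using Suc by simp
  also have "\<dots> \<le> card (identity_words G S (n * Suc j))" using identity_words_mult[of n "n * j"] by simp
  finally show ?case .
qed

definition growth :: real where "growth = real (card S) * spectral_radius G S"

text \<open>Supermultiplicativity turns the limsup into a supremum: the n-th root of the count at n
  is dominated by the corresponding root at every multiple of n. Later arguments can therefore work
  with single values of n.\<close>

lemma growth_le_iff:
  assumes "0 \<le> r" "card S > 0"
  shows "growth \<le> r \<longleftrightarrow> (\<forall>n. real (card (identity_words G S n)) \<le> r ^ n)"
proof
  let ?k = "real (card S)"
  let ?c = "\<lambda>n. real (card (identity_words G S n))"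
  let ?f = "\<lambda>n. ereal (1 / ?k * root n (?c n))"
  have k: "?k > 0" using assms by simp
  {
    assume le: "growth \<le> r"
    show "\<forall>n. ?c n \<le> r ^ n"
    proof
      fix n
      show "?c n \<le> r ^ n"
      proof (cases "n = 0")
        case True then show ?thesis using identity_words_0 by simp
      next
        case False
        have ge: "?f n \<le> ?f (n * j)" if "j > 0" for j
        proof -
          have "root n (?c n) = root (n * j) (?c n ^ j)"
            using False that by (simp add: real_root_mult_exp real_root_power_cancel)
          also have "\<dots> \<le> root (n * j) (?c (n * j))"
            using identity_words_power[of n j] False that
            by (intro real_root_le_mono) (auto simp flip: of_nat_power)
          finally show ?thesis using k by (simp add: divide_right_mono)
        qed
        have "?f n \<le> limsup ?f"
        proof (rule ccontr)
          assume "\<not> ?f n \<le> limsup ?f"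
          then have "limsup ?f < ?f n" by simp
          then have "eventually (\<lambda>m. ?f m < ?f n) sequentially"
            by (rule Limsup_lessD)
          then obtain N where N: "\<And>m. m \<ge> N \<Longrightarrow> ?f m < ?f n"
            unfolding eventually_sequentially by blast
          have "n * (N + 1) \<ge> N" using False by (cases n) auto
          with N[of "n * (N + 1)"] ge[of "N + 1"] show False by simp
        qed
        also have "\<dots> = ereal (spectral_radius G S)"
          by (rule ereal_spectral_radius[OF fin, symmetric])
        finally have "root n (?c n) \<le> growth" using k by (simp add: growth_def field_simps)
        with le have "root n (?c n) \<le> r" by simp
        then have "root n (?c n) ^ n \<le> r ^ n" by (intro power_mono real_root_ge_zero) auto
        then show ?thesis using False by simp
      qed
    qed
  next
    assume le: "\<forall>n. ?c n \<le> r ^ n"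
    have "?f n \<le> ereal (r / ?k)" for n
    proof (cases "n = 0")
      case True then show ?thesis using assms k by simp
    next
      case False
      have "root n (?c n) \<le> root n (r ^ n)" using le False by (intro real_root_le_mono) auto
      also have "\<dots> = r" using False assms by (simp add: real_root_power_cancel)
      finally show ?thesis using k by (simp add: divide_right_mono)
    qed
    then have "limsup ?f \<le> ereal (r / ?k)" by (intro Limsup_bounded always_eventually) blast
    then have "ereal (spectral_radius G S) \<le> ereal (r / ?k)"
      using ereal_spectral_radius[OF fin, of G] by simp
    then show "growth \<le> r" using k by (simp add: growth_def field_simps)
  }
qed

lemma growth_nonneg: "0 \<le> growth"
proof -
  have "0 \<le> limsup (\<lambda>n. ereal (1 / real (card S) * root n (real (card (identity_words G S n)))))"
    by (rule le_Limsup) (auto intro!: always_eventually simp: real_root_ge_zero)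
  also have "\<dots> = ereal (spectral_radius G S)"
    by (rule ereal_spectral_radius[OF fin, symmetric])
  finally have "0 \<le> spectral_radius G S" by simp
  then show ?thesis by (simp add: growth_def)
qed

lemma identity_words_le_growth:
  "card S > 0 \<Longrightarrow> real (card (identity_words G S n)) \<le> growth ^ n"
  using growth_le_iff[of growth] growth_nonneg by simp

text \<open>Multiples of \<open>L\<close> suffice because the L-th power of the count at n is at
  most the count at n * L.\<close>

lemma growth_le_if_multiples:
  assumes "0 \<le> r" "card S > 0" "L > 0"
    and le: "\<And>n. real (card (identity_words G S (L * n))) \<le> r ^ n"
  shows "growth ^ L \<le> r"
proof -
  have "growth \<le> root L r"
  proof (subst growth_le_iff)
    show "\<forall>n. real (card (identity_words G S n)) \<le> root L r ^ n"
    proof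
      fix n
      have "real (card (identity_words G S n)) ^ L \<le> real (card (identity_words G S (n * L)))"
        using identity_words_power[of n L] by (simp flip: of_nat_power)
      also have "\<dots> \<le> r ^ n" using le[of n] by (simp add: mult.commute)
      also have "\<dots> = (root L r ^ n) ^ L"
        using assms by (metis power_commutes power_mult mult.commute real_root_pow_pos2)
      finally show "real (card (identity_words G S n)) \<le> root L r ^ n"
        using assms by (metis power_mono_iff of_nat_0_le_iff real_root_ge_zero zero_le_power)
    qed
  qed (use assms in auto)
  then have "growth ^ L \<le> root L r ^ L" using growth_nonneg by (intro power_mono)
  then show ?thesis using assms by simp
qed

lemma growth_le_card: "card S > 0 \<Longrightarrow> growth \<le> card S"
  by (subst growth_le_iff) (use card_identity_words_le[OF fin, of G] in \<open>auto simp flip: of_nat_power\<close>)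

text \<open>Two words with the same value give a closed word after inverting one of them, which bounds
  every fibre of the evaluation map.\<close>

lemma card_words_le:
  assumes A: "A \<subseteq> {w. set w \<subseteq> S \<and> length w = n}" and V: "card (word_val G ` A) \<le> V"
  shows "real (card A) \<le> real V * sqrt (real (card (identity_words G S (2 * n))))"
proof (cases "A = {}")
  case False
  let ?c = "real (card (identity_words G S (2 * n)))"
  have finA: "finite A" using A finite_lists_length_eq[OF fin, of n] finite_subset by blast
  have fibre: "real (card {w \<in> A. word_val G w = g}) \<le> sqrt ?c" for g
  proof -
    let ?F = "{w \<in> A. word_val G w = g}"
    let ?f = "\<lambda>(u, v). u @ map (m_inv G) (rev v)"
    have SA: "\<And>w. w \<in> A \<Longrightarrow> set w \<subseteq> S" "\<And>w. w \<in> A \<Longrightarrow> length w = n" using A by auto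
    have inj: "inj_on (m_inv G) (\<Union>(set ` A))"
      using SA(1) sub by (intro inj_on_inverseI[of _ "m_inv G"]) (blast intro: inv_inv)
    have inj': "v = v'" if "v \<in> A" "v' \<in> A" "map (m_inv G) (rev v) = map (m_inv G) (rev v')" for v v'
    proof -
      have "rev v = rev v'"
        by (rule map_inj_on[OF that(3)]) (use that in \<open>auto intro!: inj_on_subset[OF inj]\<close>)
      then show ?thesis by simp
    qed
    have "inj_on ?f (?F \<times> ?F)"
    proof (rule inj_onI, clarsimp)
      fix u v u' v' assume "u \<in> A" "v \<in> A" "u' \<in> A" "v' \<in> A"
        "u @ map (m_inv G) (rev v) = u' @ map (m_inv G) (rev v')"
      then show "u = u' \<and> v = v'"
        using SA(2)[of u] SA(2)[of u'] inj'[of v v'] by (simp add: append_eq_append_conv)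
    qed
    then have "card (?F \<times> ?F) = card (?f ` (?F \<times> ?F))" by (simp add: card_image)
    also have "\<dots> \<le> card (identity_words G S (2 * n))"
    proof (intro card_mono finite_identity_words fin subsetI)
      fix x assume "x \<in> ?f ` (?F \<times> ?F)"
      then obtain u v where uv: "u \<in> ?F" "v \<in> ?F" "x = u @ map (m_inv G) (rev v)" by auto
      then have "set u \<subseteq> S" "set v \<subseteq> S" "length u = n" "length v = n" using SA by auto
      moreover have "word_val G x = \<one>"
        using uv(1,2) calculation(1,2) word_closed[of v]
        by (simp only: uv(3) word_append word_inverse set_word_inverse) auto
      ultimately show "x \<in> identity_words G S (2 * n)"
        using uv set_word_inverse[of v] by (auto simp: identity_words_def)
    qed
    finally have "real (card ?F) * real (card ?F) \<le> ?c"
      by (simp add: card_cartesian_product flip: of_nat_mult)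
    then show ?thesis by (intro real_le_rsqrt) (simp add: power2_eq_square)
  qed
  have "real (card A) = (\<Sum>g\<in>word_val G ` A. real (card {w \<in> A. word_val G w = g}))"
    using sum.image_gen[OF finA, of "\<lambda>_. 1::real" "word_val G"] by simp
  also have "\<dots> \<le> (\<Sum>g\<in>word_val G ` A. sqrt ?c)" by (intro sum_mono fibre)
  also have "\<dots> \<le> real V * sqrt ?c" using V by (auto intro!: mult_right_mono)
  finally show ?thesis .
qed simp

lemma card_words_le_growth:
  assumes "A \<subseteq> {w. set w \<subseteq> S \<and> length w = n}" "card (word_val G ` A) \<le> V" "card S > 0"
  shows "real (card A) \<le> real V * growth ^ n"
proof -
  have "real (card A) \<le> real V * sqrt (real (card (identity_words G S (2 * n))))"
    using card_words_le assms by blast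
  also have "\<dots> \<le> real V * sqrt (growth ^ (2 * n))"
    using identity_words_le_growth[OF assms(3), of "2 * n"] by (intro mult_left_mono) auto
  also have "sqrt (growth ^ (2 * n)) = growth ^ n"
    using growth_nonneg by (simp add: real_sqrt_unique mult.commute power_mult)
  finally show ?thesis .
qed

text \<open>A quantitative form of amenability: if the words take few values,
  \<open>card_words_le_growth\<close> puts k^n below a linear multiple of \<open>growth ^ n\<close>.
  It serves finite groups as well as the integers.\<close>

lemma spectral_radius_eq_1:
  assumes "card S > 0" "\<And>n. real (card (word_val G ` {w. set w \<subseteq> S \<and> length w = n})) \<le> A * real n + B"
  shows "spectral_radius G S = 1"
proof -
  have "real (card S) ^ n \<le> (A * real n + B) * growth ^ n" for n
  proof -
    let ?A = "{w. set w \<subseteq> S \<and> length w = n}"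
    have "real (card S) ^ n = real (card ?A)" using card_lists_length_eq[OF fin, of n] by simp
    also have "\<dots> \<le> real (card (word_val G ` ?A)) * growth ^ n"
      using card_words_le_growth assms(1) by blast
    also have "\<dots> \<le> (A * real n + B) * growth ^ n"
      using assms(2) growth_nonneg by (intro mult_right_mono) auto
    finally show ?thesis .
  qed
  then have "real (card S) \<le> growth" using growth_nonneg le_if_power_le_linear by blast
  with growth_le_card assms(1) show ?thesis by (simp add: growth_def)
qed

end

section \<open>Strict decrease of the growth rate in covers with large kernel\<close>

text \<open>Splitting off the first \<open>L\<close> letters. The map \<open>v\<close> is kept
  general so that one recursion counts words in the cover (\<open>v\<close> the identity) and their
  images downstairs (\<open>v\<close> = \<open>\<phi>\<close>).\<close>

lemma card_words_Suc_block:
  fixes v :: "'s \<Rightarrow> 'a" and K (structure)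
  assumes "group K" "finite T" "v ` T \<subseteq> carrier K" "g \<in> carrier K"
  shows "card {w. set w \<subseteq> T \<and> length w = L * Suc n \<and> word_val K (map v w) = g}
    = (\<Sum>b | set b \<subseteq> T \<and> length b = L.
        card {w. set w \<subseteq> T \<and> length w = L * n \<and>
          word_val K (map v w) = inv (word_val K (map v b)) \<otimes> g})"
proof -
  interpret group K by fact
  let ?B = "{b. set b \<subseteq> T \<and> length b = L}"
  let ?F = "\<lambda>b. {w. set w \<subseteq> T \<and> length w = L * n \<and>
      word_val K (map v w) = inv (word_val K (map v b)) \<otimes> g}"
  have cl: "word_val K (map v w) \<in> carrier K" if "set w \<subseteq> T" for w
    using that assms(3) by (intro word_val_closed) auto
  have app: "word_val K (map v (b @ w)) = word_val K (map v b) \<otimes> word_val K (map v w)"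
    if "set b \<subseteq> T" "set w \<subseteq> T" for b w
    unfolding map_append using that assms(3) by (intro word_val_append) auto
  have eq: "{w. set w \<subseteq> T \<and> length w = L * Suc n \<and> word_val K (map v w) = g}
      = (\<Union>b\<in>?B. (@) b ` ?F b)" (is "?L = ?R")
  proof (intro equalityI subsetI)
    fix w assume w: "w \<in> ?L"
    define b u where "b = take L w" and "u = drop L w"
    have bu: "w = b @ u" "set b \<subseteq> T" "set u \<subseteq> T" "length b = L" "length u = L * n"
      using w by (auto simp: b_def u_def dest: in_set_takeD in_set_dropD)
    have "word_val K (map v b) \<otimes> word_val K (map v u) = g"
      using w app[OF bu(2,3)] bu(1) by simp
    then have "word_val K (map v u) = inv (word_val K (map v b)) \<otimes> g"
      using cl bu(2,3) assms(4) inv_solve_left by metis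
    then show "w \<in> ?R" using bu by blast
  next
    fix w assume "w \<in> ?R"
    then obtain b u where bu: "b \<in> ?B" "u \<in> ?F b" "w = b @ u" by blast
    then have "word_val K (map v w) = word_val K (map v b) \<otimes> (inv (word_val K (map v b)) \<otimes> g)"
      using app[of b u] by simp
    also have "\<dots> = g" using cl[of b] bu(1) assms(4) by (simp add: m_assoc[symmetric])
    finally show "w \<in> ?L" using bu by auto
  qed
  have "card ?R = (\<Sum>b\<in>?B. card ((@) b ` ?F b))"
  proof (rule card_UN_disjoint)
    show "finite ?B" using assms(2) by (rule finite_lists_length_eq)
    show "\<forall>b\<in>?B. finite ((@) b ` ?F b)"
    proof (intro ballI finite_imageI)
      fix b
      show "finite (?F b)"
        by (rule finite_subset[OF _ finite_lists_length_eq[OF assms(2), of "L * n"]]) blast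
    qed
    show "\<forall>b\<in>?B. \<forall>b'\<in>?B. b \<noteq> b' \<longrightarrow> (@) b ` ?F b \<inter> (@) b' ` ?F b' = {}"
    proof (intro ballI impI)
      fix b b' assume "b \<in> ?B" "b' \<in> ?B" "b \<noteq> b'"
      then have "b @ u \<noteq> b' @ u'" for u u' by (simp add: append_eq_append_conv)
      then show "(@) b ` ?F b \<inter> (@) b' ` ?F b' = {}" by blast
    qed
  qed
  also have "\<dots> = (\<Sum>b\<in>?B. card (?F b))"
  proof (rule sum.cong[OF refl])
    fix b
    have "inj_on ((@) b) (?F b)" by (simp add: inj_on_def)
    then show "card ((@) b ` ?F b) = card (?F b)" by (rule card_image)
  qed
  finally show ?thesis unfolding eq .
qed

lemma word_val_hom:
  assumes "group H" "group G" "\<phi> \<in> hom H G" "set w \<subseteq> carrier H"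
  shows "\<phi> (word_val H w) = word_val G (map \<phi> w)"
proof -
  interpret group_hom H G \<phi>
    using assms by (simp add: group_hom_def group_hom_axioms_def)
  show ?thesis using assms(4)
    by (induction w) (auto simp: H.word_val_closed G.word_val_closed)
qed

text \<open>Division of n by \<open>N\<close>: each full block contributes the factor
  \<open>b N\<close> = \<open>y ^ N\<close>, and the remainder is absorbed into the minimum over the
  finitely many residues.\<close>

lemma supermultiplicative_lower_bound:
  fixes b :: "nat \<Rightarrow> real"
  assumes mult: "\<And>m n. b m * b n \<le> b (m + n)" and pos: "\<And>n. b n > 0"
    and "N > 0" "y > 0" "y ^ N = b N"
  shows "\<exists>c>0. \<forall>n. c * y ^ n \<le> b n"
proof -
  define c where "c = Min ((\<lambda>r. b r / y ^ r) ` {..<N})"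
  have "c > 0" unfolding c_def using assms by (subst Min_gr_iff) auto
  moreover have "c * y ^ n \<le> b n" for n
  proof -
    define j r where "j = n div N" and "r = n mod N"
    have n: "n = N * j + r" and r: "r < N" using \<open>N > 0\<close> by (auto simp: j_def r_def)
    have pow: "b N ^ j * b r \<le> b (N * j + r)" for j
    proof (induction j)
      case (Suc j)
      have "b N ^ Suc j * b r \<le> b N * b (N * j + r)"
        using Suc pos[of N] by simp
      also have "\<dots> \<le> b (N * Suc j + r)" using mult[of N "N * j + r"] by (simp add: add_ac)
      finally show ?case .
    qed simp
    have "c \<le> b r / y ^ r" unfolding c_def using r by (intro Min_le) auto
    then have "c * y ^ r \<le> b r" using \<open>y > 0\<close> by (simp add: field_simps)
    then have "b N ^ j * (c * y ^ r) \<le> b N ^ j * b r" using pos[of N] by (intro mult_left_mono) auto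
    also have "\<dots> \<le> b n" using pow n by simp
    also have "b N ^ j * (c * y ^ r) = c * y ^ n"
      using assms(5) by (simp add: n power_add power_mult)
    finally show ?thesis .
  qed
  ultimately show ?thesis by blast
qed

text \<open>Cauchy-Schwarz at each x with weights \<open>h (\<tau> j x)\<close>, then the
  substitution u = \<open>\<tau> j x\<close>, which turns \<open>h x\<close> into
  \<open>h (\<sigma> j u)\<close>. The sum over \<open>J\<close> is not assumed symmetric, so a
  supersolution is needed for the maps and for their inverses.\<close>

lemma schur_test:
  fixes f h :: "'a \<Rightarrow> real"
  assumes "finite J" "finite E" "E \<subseteq> V" "0 \<le> \<mu>"
    and \<tau>: "\<And>j x. j \<in> J \<Longrightarrow> x \<in> V \<Longrightarrow> \<tau> j x \<in> V"
    and st: "\<And>j x. j \<in> J \<Longrightarrow> x \<in> V \<Longrightarrow> \<sigma> j (\<tau> j x) = x"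
    and hpos: "\<And>x. x \<in> V \<Longrightarrow> h x > 0"
    and h\<tau>: "\<And>x. x \<in> V \<Longrightarrow> (\<Sum>j\<in>J. h (\<tau> j x)) \<le> \<mu> * h x"
    and h\<sigma>: "\<And>x. x \<in> V \<Longrightarrow> (\<Sum>j\<in>J. h (\<sigma> j x)) \<le> \<mu> * h x"
    and hs: "\<And>j x. j \<in> J \<Longrightarrow> x \<in> V \<Longrightarrow> h (\<sigma> j x) > 0"
  shows "L2_set (\<lambda>x. \<Sum>j\<in>J. f (\<tau> j x)) E \<le> \<mu> * L2_set f (\<Union>j\<in>J. \<tau> j ` E)"
proof -
  let ?E' = "\<Union>j\<in>J. \<tau> j ` E"
  have E': "finite ?E'" "?E' \<subseteq> V"
    using assms(1,2) \<tau>[OF _ subsetD[OF assms(3)]] by (auto simp only: image_subset_iff UN_subset_iff finite_imageI finite_UN_I)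
  have inj: "inj_on (\<tau> j) E" if "j \<in> J" for j
    by (rule inj_on_inverseI[of _ "\<sigma> j"]) (rule st[OF that subsetD[OF assms(3)]])
  have "(\<Sum>x\<in>E. (\<Sum>j\<in>J. f (\<tau> j x))\<^sup>2) \<le> (\<Sum>x\<in>E. \<mu> * h x * (\<Sum>j\<in>J. (f (\<tau> j x))\<^sup>2 / h (\<tau> j x)))"
  proof (rule sum_mono)
    fix x assume "x \<in> E"
    then have x: "x \<in> V" using assms(3) by auto
    have hx: "h (\<tau> j x) > 0" if "j \<in> J" for j by (rule hpos[OF \<tau>[OF that x]])
    have "(\<Sum>j\<in>J. f (\<tau> j x))\<^sup>2 = (\<Sum>j\<in>J. sqrt (h (\<tau> j x)) * (f (\<tau> j x) / sqrt (h (\<tau> j x))))\<^sup>2"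
      using hx by (intro arg_cong[where f = "\<lambda>t. t\<^sup>2"] sum.cong) (auto simp: less_imp_neq[THEN not_sym])
    also have "\<dots> \<le> (\<Sum>j\<in>J. (sqrt (h (\<tau> j x)))\<^sup>2) * (\<Sum>j\<in>J. (f (\<tau> j x) / sqrt (h (\<tau> j x)))\<^sup>2)"
      by (rule Cauchy_Schwarz_ineq_sum)
    also have "\<dots> = (\<Sum>j\<in>J. h (\<tau> j x)) * (\<Sum>j\<in>J. (f (\<tau> j x))\<^sup>2 / h (\<tau> j x))"
      using hx by (intro arg_cong2[where f = "(*)"] sum.cong) (auto simp: power_divide less_imp_le)
    also have "\<dots> \<le> \<mu> * h x * (\<Sum>j\<in>J. (f (\<tau> j x))\<^sup>2 / h (\<tau> j x))"
      using h\<tau>[OF x] hx by (intro mult_right_mono sum_nonneg divide_nonneg_pos) auto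
    finally show "(\<Sum>j\<in>J. f (\<tau> j x))\<^sup>2 \<le> \<mu> * h x * (\<Sum>j\<in>J. (f (\<tau> j x))\<^sup>2 / h (\<tau> j x))" .
  qed
  also have "\<dots> = \<mu> * (\<Sum>j\<in>J. \<Sum>x\<in>E. h x * ((f (\<tau> j x))\<^sup>2 / h (\<tau> j x)))"
    by (subst sum.swap) (simp add: sum_distrib_left mult_ac)
  also have "\<dots> \<le> \<mu> * (\<Sum>j\<in>J. \<Sum>u\<in>?E'. h (\<sigma> j u) * ((f u)\<^sup>2 / h u))"
  proof (intro mult_left_mono sum_mono)
    fix j assume j: "j \<in> J"
    have "(\<Sum>x\<in>E. h x * ((f (\<tau> j x))\<^sup>2 / h (\<tau> j x))) = (\<Sum>x\<in>E. h (\<sigma> j (\<tau> j x)) * ((f (\<tau> j x))\<^sup>2 / h (\<tau> j x)))"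
      using st[OF j subsetD[OF assms(3)]] by (intro sum.cong) auto
    also have "\<dots> = (\<Sum>u\<in>\<tau> j ` E. h (\<sigma> j u) * ((f u)\<^sup>2 / h u))"
      by (subst sum.reindex[OF inj[OF j]]) simp
    \<comment> \<open>Enlarging the range to a set common to all j, which allows the two sums to be
      swapped afterwards.\<close>
    also have "\<dots> \<le> (\<Sum>u\<in>?E'. h (\<sigma> j u) * ((f u)\<^sup>2 / h u))"
    proof (rule sum_mono2[OF E'(1)])
      show "\<tau> j ` E \<subseteq> ?E'" using j by blast
      fix u assume "u \<in> ?E' - \<tau> j ` E"
      then have "u \<in> V" using E'(2) by blast
      then show "0 \<le> h (\<sigma> j u) * ((f u)\<^sup>2 / h u)"
        using hs[OF j \<open>u \<in> V\<close>] hpos[OF \<open>u \<in> V\<close>] by simp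
    qed
    finally show "(\<Sum>x\<in>E. h x * ((f (\<tau> j x))\<^sup>2 / h (\<tau> j x))) \<le> (\<Sum>u\<in>?E'. h (\<sigma> j u) * ((f u)\<^sup>2 / h u))" .
  qed (rule assms(4))
  also have "(\<Sum>j\<in>J. \<Sum>u\<in>?E'. h (\<sigma> j u) * ((f u)\<^sup>2 / h u)) = (\<Sum>u\<in>?E'. (\<Sum>j\<in>J. h (\<sigma> j u)) * ((f u)\<^sup>2 / h u))"
    by (subst sum.swap, intro sum.cong refl, rule sum_distrib_right[symmetric])
  also have "\<dots> \<le> (\<Sum>u\<in>?E'. \<mu> * (f u)\<^sup>2)"
  proof (rule sum_mono)
    fix u assume "u \<in> ?E'"
    then have u: "u \<in> V" using E' by blast
    have "(\<Sum>j\<in>J. h (\<sigma> j u)) * ((f u)\<^sup>2 / h u) \<le> \<mu> * h u * ((f u)\<^sup>2 / h u)"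
      using h\<sigma>[OF u] hpos[OF u] by (intro mult_right_mono) auto
    then show "(\<Sum>j\<in>J. h (\<sigma> j u)) * ((f u)\<^sup>2 / h u) \<le> \<mu> * (f u)\<^sup>2" using hpos[OF u] by simp
  qed
  also have "\<mu> * (\<Sum>u\<in>?E'. \<mu> * (f u)\<^sup>2) = \<mu>\<^sup>2 * (\<Sum>u\<in>?E'. (f u)\<^sup>2)"
    by (simp add: sum_distrib_left power2_eq_square mult_ac)
  finally have "(\<Sum>x\<in>E. (\<Sum>j\<in>J. f (\<tau> j x))\<^sup>2) \<le> \<mu>\<^sup>2 * (\<Sum>u\<in>?E'. (f u)\<^sup>2)"
    using assms(4) by (simp add: mult_left_mono)
  then have "sqrt (\<Sum>x\<in>E. (\<Sum>j\<in>J. f (\<tau> j x))\<^sup>2) \<le> sqrt (\<mu>\<^sup>2 * (\<Sum>u\<in>?E'. (f u)\<^sup>2))"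
    by (rule real_sqrt_le_mono)
  then show ?thesis using assms(4) by (simp add: L2_set_def real_sqrt_mult)
qed

text \<open>The abstract source of the drop: words \<open>Q\<close> of equal length in the kernel of
  \<open>\<phi>\<close>, and a supersolution \<open>h\<close> certifying that their sum has norm at
  most \<open>\<mu>\<close> upstairs. Downstairs the same sum is \<open>card Q\<close> times the
  identity.\<close>

locale kernel_words = cover: marked_group \<Gamma> T + base: group G
  for \<Gamma> :: "('a, 'b) monoid_scheme" and T and G :: "('c, 'd) monoid_scheme" +
  fixes \<phi> :: "'a \<Rightarrow> 'c" and L :: nat and Q :: "'a list set" and \<mu> :: real and h :: "'a \<Rightarrow> real"
  assumes hom: "\<phi> \<in> hom \<Gamma> G" and T_pos: "card T > 0" and L_pos: "L > 0"
    and Q: "Q \<subseteq> {w. set w \<subseteq> T \<and> length w = L}" "Q \<noteq> {}"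
    and kernel: "\<And>w. w \<in> Q \<Longrightarrow> word_val G (map \<phi> w) = \<one>\<^bsub>G\<^esub>"
    and \<mu>_pos: "0 < \<mu>" and \<mu>_le: "\<mu> \<le> card Q"
    and h_pos: "\<And>x. x \<in> carrier \<Gamma> \<Longrightarrow> h x > 0"
    and h_super: "\<And>x. x \<in> carrier \<Gamma> \<Longrightarrow> (\<Sum>w\<in>Q. h (word_val \<Gamma> w \<otimes>\<^bsub>\<Gamma>\<^esub> x)) \<le> \<mu> * h x"
    and h_super_inv: "\<And>x. x \<in> carrier \<Gamma> \<Longrightarrow>
      (\<Sum>w\<in>Q. h (inv\<^bsub>\<Gamma>\<^esub> (word_val \<Gamma> w) \<otimes>\<^bsub>\<Gamma>\<^esub> x)) \<le> \<mu> * h x"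
begin

definition blocks :: "'a list set" where "blocks = {b. set b \<subseteq> T \<and> length b = L}"

definition image_val :: "'a list \<Rightarrow> 'c" where "image_val b = word_val G (map \<phi> b)"

definition excess :: real where "excess = real (card Q) - \<mu>"

text \<open>In the cover, the words of \<open>Q\<close> act with norm at most \<open>\<mu>\<close>, whereas downstairs they act as
  \<open>card Q\<close> copies of the identity. The operator \<open>step\<close> keeps the smaller weight downstairs.\<close>

definition step :: "('c \<Rightarrow> real) \<Rightarrow> 'c \<Rightarrow> real" where
  "step f g = (\<Sum>b\<in>blocks. (if b \<in> Q then \<mu> / card Q else 1) * f (inv\<^bsub>G\<^esub> (image_val b) \<otimes>\<^bsub>G\<^esub> g))"

text \<open>This shape makes it evident that the operator commutes with \<open>step\<close>;
  \<open>full_step_eq\<close> recovers the plain sum over all blocks.\<close>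

definition full_step :: "('c \<Rightarrow> real) \<Rightarrow> 'c \<Rightarrow> real" where
  "full_step f g = step f g + excess * f g"

definition \<delta> :: "'c \<Rightarrow> real" where "\<delta> g = of_bool (g = \<one>\<^bsub>G\<^esub>)"

lemma fin_blocks: "finite blocks"
  unfolding blocks_def by (rule finite_lists_length_eq[OF cover.fin])

lemma Q_blocks: "Q \<subseteq> blocks" and fin_Q: "finite Q" and card_Q: "card Q > 0"
proof -
  show "Q \<subseteq> blocks" using Q by (simp add: blocks_def)
  then show "finite Q" using fin_blocks by (rule finite_subset)
  then show "card Q > 0" using Q by (simp add: card_gt_0_iff)
qed

lemma \<phi>_T: "\<phi> ` T \<subseteq> carrier G"
  using hom cover.sub by (auto simp: hom_def)

lemma image_val_closed: "b \<in> blocks \<Longrightarrow> image_val b \<in> carrier G"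
  unfolding image_val_def using \<phi>_T by (intro base.word_val_closed) (auto simp: blocks_def)

lemma image_val_hom: "b \<in> blocks \<Longrightarrow> \<phi> (word_val \<Gamma> b) = image_val b"
  unfolding image_val_def blocks_def using cover.sub
  by (intro word_val_hom cover.is_group base.is_group hom) auto

lemma sum_blocks: "(\<Sum>b\<in>blocks. F b) = (\<Sum>b\<in>Q. F b) + (\<Sum>b\<in>blocks - Q. F b)" for F :: "'a list \<Rightarrow> real"
  using sum.subset_diff[OF Q_blocks fin_blocks, of F] by simp

lemma step_eq:
  assumes "g \<in> carrier G"
  shows "step f g = \<mu> * f g + (\<Sum>b\<in>blocks - Q. f (inv\<^bsub>G\<^esub> (image_val b) \<otimes>\<^bsub>G\<^esub> g))"
proof -
  have "(\<Sum>b\<in>Q. (if b \<in> Q then \<mu> / card Q else 1) * f (inv\<^bsub>G\<^esub> (image_val b) \<otimes>\<^bsub>G\<^esub> g))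
      = (\<Sum>b\<in>Q. \<mu> / card Q * f g)"
    using assms kernel by (intro sum.cong) (auto simp: image_val_def)
  also have "\<dots> = \<mu> * f g" using card_Q by simp
  moreover have "(\<Sum>b\<in>blocks - Q. (if b \<in> Q then \<mu> / card Q else 1) * f (inv\<^bsub>G\<^esub> (image_val b) \<otimes>\<^bsub>G\<^esub> g))
      = (\<Sum>b\<in>blocks - Q. f (inv\<^bsub>G\<^esub> (image_val b) \<otimes>\<^bsub>G\<^esub> g))"
    by (intro sum.cong) auto
  ultimately show ?thesis
    unfolding step_def sum_blocks by simp
qed

lemma full_step_eq:
  assumes "g \<in> carrier G"
  shows "full_step f g = (\<Sum>b\<in>blocks. f (inv\<^bsub>G\<^esub> (image_val b) \<otimes>\<^bsub>G\<^esub> g))"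
proof -
  have "(\<Sum>b\<in>Q. f (inv\<^bsub>G\<^esub> (image_val b) \<otimes>\<^bsub>G\<^esub> g)) = (\<Sum>b\<in>Q. f g)"
    using assms kernel by (intro sum.cong) (auto simp: image_val_def)
  then show ?thesis
    unfolding full_step_def step_eq[OF assms] sum_blocks excess_def by (simp add: algebra_simps)
qed

lemma step_linear: "step (\<lambda>g. f g + c * f' g) = (\<lambda>g. step f g + c * step f' g)"
  by (auto simp: step_def algebra_simps sum.distrib sum_distrib_left)

lemma step_mono: "(\<And>g. f g \<le> f' g) \<Longrightarrow> step f g \<le> step f' g"
  unfolding step_def using \<mu>_pos by (intro sum_mono mult_left_mono) auto

lemma step_funpow_mono: "(\<And>g. f g \<le> f' g) \<Longrightarrow> (step ^^ n) f g \<le> (step ^^ n) f' g"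
  by (induction n arbitrary: g) (auto intro: step_mono)

lemma step_funpow_scale: "(step ^^ n) (\<lambda>g. c * f g) = (\<lambda>g. c * (step ^^ n) f g)"
  using step_linear[of "\<lambda>_. 0"] by (induction n) (auto simp: step_def)

lemma step_funpow_nonneg: "0 \<le> (step ^^ n) \<delta> g"
  using step_funpow_mono[of "\<lambda>_. 0 * \<delta> g" \<delta> n g] step_funpow_scale[of n 0 "\<lambda>_. \<delta> g"]
  by (simp add: \<delta>_def)

lemma full_step_commute: "(full_step ^^ n) (step f) = step ((full_step ^^ n) f)"
proof (induction n)
  case (Suc n)
  have "full_step (step f') = step (full_step f')" for f'
    unfolding full_step_def using step_linear[of "step f'" excess f'] by simp
  with Suc show ?case by simp
qed simp

definition reduced_count :: "nat \<Rightarrow> real" where "reduced_count n = (step ^^ n) \<delta> \<one>\<^bsub>G\<^esub>"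

text \<open>All values of the iterates are nonnegative, so keeping only the mass that has returned
  to the identity and restarting from it gives a lower bound.\<close>

lemma reduced_count_mult: "reduced_count m * reduced_count n \<le> reduced_count (m + n)"
proof -
  have "reduced_count n * \<delta> g \<le> (step ^^ n) \<delta> g" for g
    using step_funpow_nonneg[of n g] by (auto simp: \<delta>_def reduced_count_def)
  then have "(step ^^ m) (\<lambda>g. reduced_count n * \<delta> g) \<one>\<^bsub>G\<^esub> \<le> (step ^^ m) ((step ^^ n) \<delta>) \<one>\<^bsub>G\<^esub>"
    by (rule step_funpow_mono)
  then show ?thesis
    unfolding step_funpow_scale reduced_count_def by (simp add: funpow_add mult.commute)
qed

lemma reduced_count_pos: "reduced_count n > 0"
proof (induction n)
  case 0
  show ?case by (simp add: reduced_count_def \<delta>_def)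
next
  case (Suc n)
  have "0 < \<mu>" by (rule \<mu>_pos)
  also have "\<mu> \<le> reduced_count 1"
    unfolding reduced_count_def by (simp add: step_eq) (simp add: \<delta>_def sum_nonneg)
  finally have "0 < reduced_count 1 * reduced_count n" using Suc by simp
  also have "\<dots> \<le> reduced_count (Suc n)" using reduced_count_mult[of 1 n] by simp
  finally show ?case .
qed

lemma full_step_count:
  assumes "g \<in> carrier G"
  shows "(full_step ^^ n) \<delta> g
    = real (card {w. set w \<subseteq> T \<and> length w = L * n \<and> word_val G (map \<phi> w) = g})"
  using assms
proof (induction n arbitrary: g)
  case 0
  have "{w. set w \<subseteq> T \<and> length w = L * 0 \<and> word_val G (map \<phi> w) = g} = (if g = \<one>\<^bsub>G\<^esub> then {[]} else {})"
    by auto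
  then show ?case by (simp add: \<delta>_def)
next
  case (Suc n)
  have "(full_step ^^ Suc n) \<delta> g
      = (\<Sum>b\<in>blocks. (full_step ^^ n) \<delta> (inv\<^bsub>G\<^esub> (image_val b) \<otimes>\<^bsub>G\<^esub> g))"
    using full_step_eq[OF Suc.prems] by simp
  also have "\<dots> = (\<Sum>b\<in>blocks. real (card {w. set w \<subseteq> T \<and> length w = L * n \<and>
      word_val G (map \<phi> w) = inv\<^bsub>G\<^esub> (image_val b) \<otimes>\<^bsub>G\<^esub> g}))"
    using Suc image_val_closed by (intro sum.cong) auto
  also have "\<dots> = real (card {w. set w \<subseteq> T \<and> length w = L * Suc n \<and> word_val G (map \<phi> w) = g})"
    unfolding card_words_Suc_block[OF base.is_group cover.fin \<phi>_T Suc.prems]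
    by (simp add: blocks_def image_val_def)
  finally show ?case .
qed

definition cover_count :: "nat \<Rightarrow> 'a \<Rightarrow> real" where
  "cover_count n x = real (card {w. set w \<subseteq> T \<and> length w = L * n \<and> word_val \<Gamma> w = x})"

lemma cover_count_Suc:
  assumes "x \<in> carrier \<Gamma>"
  shows "cover_count (Suc n) x = (\<Sum>b\<in>blocks. cover_count n (inv\<^bsub>\<Gamma>\<^esub> (word_val \<Gamma> b) \<otimes>\<^bsub>\<Gamma>\<^esub> x))"
  using card_words_Suc_block[OF cover.is_group cover.fin _ assms, of "\<lambda>x. x" L n] cover.sub
  by (simp add: cover_count_def blocks_def)

text \<open>Blocks outside \<open>Q\<close> are estimated one at a time by the triangle inequality,
  those in \<open>Q\<close> jointly by the Schur test, which gains \<open>\<mu>\<close> over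
  \<open>card Q\<close>. Finite parts of a fibre avoid any question of summability.\<close>

lemma L2_set_cover_count_le:
  assumes "finite E" "E \<subseteq> carrier \<Gamma>" "g \<in> carrier G" "\<And>x. x \<in> E \<Longrightarrow> \<phi> x = g"
  shows "L2_set (cover_count n) E \<le> (step ^^ n) \<delta> g"
  using assms
proof (induction n arbitrary: E g)
  case 0
  have one: "cover_count 0 x = of_bool (x = \<one>\<^bsub>\<Gamma>\<^esub>)" for x
  proof -
    have "{w. set w \<subseteq> T \<and> length w = L * 0 \<and> word_val \<Gamma> w = x} = (if x = \<one>\<^bsub>\<Gamma>\<^esub> then {[]} else {})"
      by auto
    then show ?thesis by (simp add: cover_count_def)
  qed
  have "(\<Sum>x\<in>E. (cover_count 0 x)\<^sup>2) = (\<Sum>x\<in>E. if x = \<one>\<^bsub>\<Gamma>\<^esub> then 1 else 0)"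
    by (intro sum.cong) (auto simp: one)
  also have "\<dots> = of_bool (\<one>\<^bsub>\<Gamma>\<^esub> \<in> E)"
    using 0 by (simp add: sum.delta)
  also have "\<dots> \<le> \<delta> g"
    using 0(4)[of "\<one>\<^bsub>\<Gamma>\<^esub>"] hom_one[OF hom cover.is_group base.is_group] by (auto simp: \<delta>_def)
  finally have "L2_set (cover_count 0) E \<le> sqrt (\<delta> g)"
    unfolding L2_set_def by (rule real_sqrt_le_mono)
  also have "sqrt (\<delta> g) = (step ^^ 0) \<delta> g" by (simp add: \<delta>_def)
  finally show ?case .
next
  case (Suc n)
  let ?t = "\<lambda>b x. inv\<^bsub>\<Gamma>\<^esub> (word_val \<Gamma> b) \<otimes>\<^bsub>\<Gamma>\<^esub> x"
  have val: "word_val \<Gamma> b \<in> carrier \<Gamma>" if "b \<in> blocks" for b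
    using that cover.word_closed by (simp add: blocks_def)
  have \<phi>t: "\<phi> (?t b x) = inv\<^bsub>G\<^esub> (image_val b) \<otimes>\<^bsub>G\<^esub> g" if "b \<in> blocks" "x \<in> E" for b x
  proof -
    interpret group_hom \<Gamma> G \<phi>
      using hom cover.is_group base.is_group by (simp add: group_hom_def group_hom_axioms_def)
    have "x \<in> carrier \<Gamma>" using Suc.prems that by auto
    then show ?thesis using val[OF that(1)] Suc.prems(4)[OF that(2)] image_val_hom[OF that(1)] by simp
  qed
  have tE: "?t b ` E \<subseteq> carrier \<Gamma>" if "b \<in> blocks" for b
    using val[OF that] Suc.prems(2) by auto
  have other: "L2_set (\<lambda>x. cover_count n (?t b x)) E \<le> (step ^^ n) \<delta> (inv\<^bsub>G\<^esub> (image_val b) \<otimes>\<^bsub>G\<^esub> g)"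
    if "b \<in> blocks" for b
  proof -
    have "inj_on (?t b) E"
      using val[OF that] Suc.prems(2) by (intro inj_onI) (auto simp: subset_iff)
    then have "L2_set (\<lambda>x. cover_count n (?t b x)) E = L2_set (cover_count n) (?t b ` E)"
      by (simp add: L2_set_def sum.reindex)
    also have "\<dots> \<le> (step ^^ n) \<delta> (inv\<^bsub>G\<^esub> (image_val b) \<otimes>\<^bsub>G\<^esub> g)"
      using Suc.prems \<phi>t[OF that] tE[OF that] image_val_closed[OF that] by (intro Suc.IH) auto
    finally show ?thesis .
  qed
  have QE: "L2_set (\<lambda>x. \<Sum>b\<in>Q. cover_count n (?t b x)) E \<le> \<mu> * (step ^^ n) \<delta> g"
  proof -
    have Qc: "word_val \<Gamma> b \<in> carrier \<Gamma>" if "b \<in> Q" for b using that val Q_blocks by auto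
    have "L2_set (\<lambda>x. \<Sum>b\<in>Q. cover_count n (?t b x)) E
        \<le> \<mu> * L2_set (cover_count n) (\<Union>b\<in>Q. ?t b ` E)"
      by (rule schur_test[where V = "carrier \<Gamma>" and \<sigma> = "\<lambda>b x. word_val \<Gamma> b \<otimes>\<^bsub>\<Gamma>\<^esub> x" and h = h])
        (use fin_Q Suc.prems(1,2) \<mu>_pos Qc h_pos h_super h_super_inv
          in \<open>simp_all add: cover.m_assoc[symmetric]\<close>)
    \<comment> \<open>Words of \<open>Q\<close> lie in the kernel, so the translates stay over
      \<open>g\<close> and the induction hypothesis covers their union at once.\<close>
    also have "L2_set (cover_count n) (\<Union>b\<in>Q. ?t b ` E) \<le> (step ^^ n) \<delta> g"
    proof (rule Suc.IH)
      show "finite (\<Union>b\<in>Q. ?t b ` E)" using fin_Q Suc.prems(1) by simp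
      show "(\<Union>b\<in>Q. ?t b ` E) \<subseteq> carrier \<Gamma>" using tE Q_blocks by blast
      fix y assume "y \<in> (\<Union>b\<in>Q. ?t b ` E)"
      then obtain b x where "b \<in> Q" "x \<in> E" "y = ?t b x" by blast
      then show "\<phi> y = g"
        using \<phi>t[of b x] Q_blocks kernel[of b] Suc.prems(3) by (auto simp: image_val_def)
    qed fact
    finally show ?thesis using \<mu>_pos by simp
  qed
  have "L2_set (cover_count (Suc n)) E
      = L2_set (\<lambda>x. (\<Sum>b\<in>Q. cover_count n (?t b x)) + (\<Sum>b\<in>blocks - Q. cover_count n (?t b x))) E"
    using Suc.prems(2) by (intro L2_set_cong refl) (auto simp: cover_count_Suc sum_blocks subset_iff)
  also have "\<dots> \<le> L2_set (\<lambda>x. \<Sum>b\<in>Q. cover_count n (?t b x)) E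
      + L2_set (\<lambda>x. \<Sum>b\<in>blocks - Q. cover_count n (?t b x)) E"
    by (rule L2_set_triangle_ineq)
  also have "L2_set (\<lambda>x. \<Sum>b\<in>D. cover_count n (?t b x)) E \<le> (\<Sum>b\<in>D. L2_set (\<lambda>x. cover_count n (?t b x)) E)"
    if "finite D" for D
    using that
  proof (induction D)
    case (insert b D)
    then show ?case
      using L2_set_triangle_ineq[of "\<lambda>x. cover_count n (?t b x)" "\<lambda>x. \<Sum>b\<in>D. cover_count n (?t b x)" E]
      by simp
  qed (simp add: L2_set_def)
  then have "L2_set (\<lambda>x. \<Sum>b\<in>blocks - Q. cover_count n (?t b x)) E
      \<le> (\<Sum>b\<in>blocks - Q. L2_set (\<lambda>x. cover_count n (?t b x)) E)" using fin_blocks by blast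
  also have "(\<Sum>b\<in>blocks - Q. L2_set (\<lambda>x. cover_count n (?t b x)) E)
      \<le> (\<Sum>b\<in>blocks - Q. (step ^^ n) \<delta> (inv\<^bsub>G\<^esub> (image_val b) \<otimes>\<^bsub>G\<^esub> g))"
    using other by (intro sum_mono) auto
  finally show ?case using QE step_eq[OF Suc.prems(3), of "(step ^^ n) \<delta>"] by simp
qed

text \<open>If the reduced counts grow at rate y, adding \<open>excess\<close> times the identity to
  \<open>step\<close> produces rate y + \<open>excess\<close> downstairs, which \<open>R ^ L\<close>
  bounds. The counts of the cover lie below the reduced counts.\<close>

theorem growth_power_le:
  assumes "0 \<le> R"
    and R: "\<And>n. real (card {w. set w \<subseteq> T \<and> length w = n \<and> word_val G (map \<phi> w) = \<one>\<^bsub>G\<^esub>}) \<le> R ^ n"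
  shows "cover.growth ^ L \<le> R ^ L - excess"
proof -
  have bound: "y + excess \<le> R ^ L" if y: "N > 0" "y > 0" "y ^ N = reduced_count N" for y N
  proof -
    obtain c where c: "c > 0" "\<And>n. c * y ^ n \<le> reduced_count n"
      using supermultiplicative_lower_bound[of reduced_count N y] reduced_count_mult reduced_count_pos y
      by blast
    \<comment> \<open>A binomial expansion in disguise: one \<open>full_step\<close> either advances
      the exponent of \<open>step\<close> or picks up the factor \<open>excess\<close>, whence the
      generalisation over \<open>m\<close>.\<close>
    have grow: "c * y ^ m * (y + excess) ^ n \<le> (full_step ^^ n) ((step ^^ m) \<delta>) \<one>\<^bsub>G\<^esub>" for n m
    proof (induction n arbitrary: m)
      case 0
      then show ?case using c by (simp add: reduced_count_def)
    next
      case (Suc n)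
      have "c * y ^ m * (y + excess) ^ Suc n
          = c * y ^ Suc m * (y + excess) ^ n + excess * (c * y ^ m * (y + excess) ^ n)"
        by (simp add: algebra_simps)
      also have "\<dots> \<le> (full_step ^^ n) ((step ^^ Suc m) \<delta>) \<one>\<^bsub>G\<^esub>
          + excess * (full_step ^^ n) ((step ^^ m) \<delta>) \<one>\<^bsub>G\<^esub>"
        using Suc[of m] Suc[of "Suc m"] by (intro add_mono mult_left_mono) (use \<mu>_le in \<open>auto simp: excess_def\<close>)
      also have "\<dots> = (full_step ^^ Suc n) ((step ^^ m) \<delta>) \<one>\<^bsub>G\<^esub>"
        by (simp add: full_step_def full_step_commute)
      finally show ?case .
    qed
    show ?thesis
    proof (rule le_if_power_le_const)
      show "0 \<le> R ^ L" using assms by simp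
      fix n
      have "c * (y + excess) ^ n \<le> (full_step ^^ n) \<delta> \<one>\<^bsub>G\<^esub>" using grow[of 0 n] by simp
      also have "\<dots> \<le> R ^ (L * n)" using R[of "L * n"] by (simp add: full_step_count)
      finally show "(y + excess) ^ n \<le> 1 / c * (R ^ L) ^ n"
        using c(1) by (simp add: field_simps power_mult)
    qed
  qed
  \<comment> \<open>Only the sign is wanted, and the case N = 1 supplies it, as the reduced count at
    1 is positive.\<close>
  have nn: "0 \<le> R ^ L - excess"
    using bound[of 1 "reduced_count 1"] reduced_count_pos[of 1] by simp
  show ?thesis
  proof (rule cover.growth_le_if_multiples[OF nn T_pos L_pos])
    fix n
    have "real (card (identity_words \<Gamma> T (L * n))) = cover_count n \<one>\<^bsub>\<Gamma>\<^esub>"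
      by (simp add: cover_count_def identity_words_def)
    also have "\<dots> = L2_set (cover_count n) {\<one>\<^bsub>\<Gamma>\<^esub>}" by (simp add: L2_set_def cover_count_def)
    also have "\<dots> \<le> reduced_count n"
      unfolding reduced_count_def using hom_one[OF hom cover.is_group base.is_group]
      by (intro L2_set_cover_count_le) auto
    also have "\<dots> \<le> (R ^ L - excess) ^ n"
    proof (cases "n = 0")
      case True
      then show ?thesis by (simp add: reduced_count_def \<delta>_def)
    next
      case False
      define y where "y = root n (reduced_count n)"
      have y: "y > 0" "y ^ n = reduced_count n"
        using False reduced_count_pos[of n] by (auto simp: y_def)
      then have "y \<le> R ^ L - excess" using bound[of n y] False by simp
      then show ?thesis using y by (metis less_imp_le power_mono)
    qed
    finally show "real (card (identity_words \<Gamma> T (L * n))) \<le> (R ^ L - excess) ^ n" .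
  qed
qed

end

section \<open>Groups generated by permutations\<close>

text \<open>Products of letters without inverses; this is a group once every letter has its inverse
  among the letters.\<close>

definition perm_group :: "('y \<Rightarrow> 'y) set \<Rightarrow> ('y \<Rightarrow> 'y) monoid" where
  "perm_group T = \<lparr>carrier = (\<lambda>w. foldr (\<circ>) w id) ` lists T, mult = (\<circ>), one = id\<rparr>"

lemma perm_group_simps [simp]:
  "mult (perm_group T) = (\<circ>)" "one (perm_group T) = id"
  by (simp_all add: perm_group_def)

lemma foldr_comp_append: "foldr (\<circ>) (u @ v) id = foldr (\<circ>) u id \<circ> foldr (\<circ>) v id"
  by (induction u) (simp_all add: comp_assoc del: foldr_append)

lemma carrier_perm_group: "x \<in> carrier (perm_group T) \<longleftrightarrow> (\<exists>w. set w \<subseteq> T \<and> x = foldr (\<circ>) w id)"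
  by (auto simp: perm_group_def)

lemma marked_perm_group:
  assumes "finite T" and inv: "\<And>t. t \<in> T \<Longrightarrow> \<exists>t'\<in>T. t' \<circ> t = id"
  shows "marked_group (perm_group T) T"
proof -
  let ?G = "perm_group T"
  have inv_word: "\<exists>w'. set w' \<subseteq> T \<and> foldr (\<circ>) w' id \<circ> foldr (\<circ>) w id = id" if "set w \<subseteq> T" for w
    using that
  proof (induction w)
    case Nil
    then show ?case by (intro exI[of _ "[]"]) simp
  next
    case (Cons t w)
    then obtain w' t' where w': "set w' \<subseteq> T" "foldr (\<circ>) w' id \<circ> foldr (\<circ>) w id = id"
      and t': "t' \<in> T" "t' \<circ> t = id" using inv[of t] by (simp only: set_simps insert_subset) blast
    have "foldr (\<circ>) (w' @ [t']) id \<circ> foldr (\<circ>) (t # w) id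
        = foldr (\<circ>) w' id \<circ> (t' \<circ> t) \<circ> foldr (\<circ>) w id"
      by (simp add: foldr_comp_append comp_assoc del: foldr_append)
    also have "\<dots> = id" using w' t' by simp
    finally have "foldr (\<circ>) (w' @ [t']) id \<circ> foldr (\<circ>) (t # w) id = id" .
    moreover have "set (w' @ [t']) \<subseteq> T" using w' t' by simp
    ultimately show ?case by blast
  qed
  have T_sub: "T \<subseteq> carrier ?G"
  proof
    fix t assume "t \<in> T"
    then show "t \<in> carrier ?G" unfolding carrier_perm_group by (intro exI[of _ "[t]"]) simp
  qed
  interpret group ?G
  proof (rule groupI)
    fix x y assume "x \<in> carrier ?G" "y \<in> carrier ?G"
    then obtain u v where "set u \<subseteq> T" "set v \<subseteq> T" "x = foldr (\<circ>) u id" "y = foldr (\<circ>) v id"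
      unfolding carrier_perm_group by blast
    then show "x \<otimes>\<^bsub>?G\<^esub> y \<in> carrier ?G"
      unfolding carrier_perm_group by (intro exI[of _ "u @ v"]) (simp add: foldr_comp_append del: foldr_append)
  next
    show "\<one>\<^bsub>?G\<^esub> \<in> carrier ?G" unfolding carrier_perm_group by (intro exI[of _ "[]"]) simp
  next
    fix x assume "x \<in> carrier ?G"
    then obtain w where "set w \<subseteq> T" "x = foldr (\<circ>) w id" unfolding carrier_perm_group by blast
    with inv_word[of w] show "\<exists>y\<in>carrier ?G. y \<otimes>\<^bsub>?G\<^esub> x = \<one>\<^bsub>?G\<^esub>"
      by (auto simp: carrier_perm_group Bex_def)
  qed (simp_all add: comp_assoc)
  have inv_T: "m_inv ?G t \<in> T" if t: "t \<in> T" for t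
  proof -
    obtain t' where t': "t' \<in> T" "t' \<circ> t = id" using inv[OF t] by blast
    then have "m_inv ?G t = t'" using t T_sub by (intro inv_equality) auto
    then show ?thesis using t' by simp
  qed
  have "m_inv ?G ` T = T"
  proof
    show "T \<subseteq> m_inv ?G ` T"
    proof
      fix t assume "t \<in> T"
      then show "t \<in> m_inv ?G ` T"
        using inv_T[of t] T_sub by (intro image_eqI[of _ _ "m_inv ?G t"]) auto
    qed
  qed (use inv_T in auto)
  moreover have "generate ?G T = carrier ?G"
  proof
    show "carrier ?G \<subseteq> generate ?G T"
    proof
      fix x assume "x \<in> carrier ?G"
      then obtain w where w: "set w \<subseteq> T" "x = foldr (\<circ>) w id" unfolding carrier_perm_group by blast
      have "foldr (\<circ>) w id \<in> generate ?G T" using w(1)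
      proof (induction w)
        case Nil
        show ?case using generate.one[of ?G T] unfolding foldr_Nil id_apply perm_group_simps .
      next
        case (Cons t w)
        then have "t \<in> T" "set w \<subseteq> T" by simp_all
        from generate.eng[OF generate.incl[OF this(1)] Cons.IH[OF this(2)]] show ?case unfolding foldr_Cons o_apply perm_group_simps .
      qed
      then show "x \<in> generate ?G T" using w by simp
    qed
  qed (rule generate_incl[OF T_sub])
  ultimately show ?thesis
    using assms(1) T_sub is_group
    by (simp add: marked_group_def marked_group_axioms_def symmetric_generating_set_def)
qed

lemma (in marked_group) spectral_radius_mem: "spectral_radius G S \<in> X_rho (card S)"
  using spectral_radius_in_X_rho[OF is_group sgs refl] .

section \<open>A free product of three groups of order two\<close>

text \<open>The reduced words are the lists without equal neighbours; all other lists are left fixed, so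
  that \<open>toggle j\<close> is an involution of the whole type.\<close>

definition toggle :: "nat \<Rightarrow> nat list \<Rightarrow> nat list" where
  "toggle j u = (if j < 3 \<and> distinct_adj u then
     (if u \<noteq> [] \<and> hd u = j then tl u else j # u) else u)"

lemma distinct_adj_toggle [simp]: "distinct_adj (toggle j u) \<longleftrightarrow> distinct_adj u"
  by (cases u) (auto simp: toggle_def distinct_adj_Cons)

lemma toggle_toggle [simp]: "toggle j (toggle j u) = u"
  by (cases u) (auto simp: toggle_def distinct_adj_Cons)

lemma toggle_ge_3 [simp]: "j \<ge> 3 \<Longrightarrow> toggle j u = u"
  by (simp add: toggle_def)

lemma toggle_funpow_even: "even n \<Longrightarrow> (toggle j ^^ n) u = u"
proof (induction n rule: less_induct)
  case (less n)
  show ?case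
  proof (cases "n = 0")
    case False
    then obtain m where m: "n = Suc (Suc m)" using less.prems by (cases n; cases "n - 1") auto
    with less show ?thesis by simp
  qed simp
qed

text \<open>The ratio 1 / sqrt 2 is the optimal one on the 3-regular tree: a parent contributes sqrt
  2 and two children 1 / sqrt 2 each, in total 2 sqrt 2.\<close>

definition height_weight :: "nat list \<Rightarrow> real" where
  "height_weight u = (1 / sqrt 2) ^ length u"

lemma height_weight_super:
  assumes "distinct_adj u"
  shows "(\<Sum>j<3. height_weight (toggle j u)) \<le> 2 * sqrt 2 * height_weight u"
proof -
  have s: "sqrt 2 * sqrt 2 = (2::real)" by simp
  have three: "{..<3::nat} = {0, 1, 2}" by auto
  show ?thesis
  proof (cases u)
    case Nil
    have "3 * (1 / sqrt 2) \<le> 2 * sqrt (2::real)" by (simp add: field_simps)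
    then show ?thesis using Nil by (simp add: three toggle_def height_weight_def)
  next
    case (Cons i v)
    have up: "height_weight (toggle j u) = height_weight u / sqrt 2" if "j < 3" "j \<noteq> i" for j
      using that Cons assms by (simp add: toggle_def height_weight_def)
    have down: "height_weight (toggle i u) = height_weight u * sqrt 2" if "i < 3"
      using that Cons assms by (simp add: toggle_def height_weight_def)
    have pos: "height_weight u > 0" by (simp add: height_weight_def)
    have half: "height_weight u / sqrt 2 = height_weight u * sqrt 2 / 2"
      using s by (simp add: field_simps)
    show ?thesis
    proof (cases "i < 3")
      case True
      then have "(\<Sum>j<3. height_weight (toggle j u))
          = height_weight u * sqrt 2 + (\<Sum>j\<in>{..<3} - {i}. height_weight u / sqrt 2)"
        using up down by (subst sum.remove[of _ i]) auto
      also have "\<dots> = 2 * sqrt 2 * height_weight u" unfolding half using True by simp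
      finally show ?thesis by simp
    next
      \<comment> \<open>Entries of the list are not bounded by 3. Here no toggle removes the head,
        so all three moves lead away from the root.\<close>
      case False
      then have "(\<Sum>j<3. height_weight (toggle j u)) = (\<Sum>j<(3::nat). height_weight u / sqrt 2)"
        using up by (intro sum.cong) auto
      also have "\<dots> = 3 / 2 * (height_weight u * sqrt 2)" unfolding half by simp
      also have "\<dots> \<le> 2 * (height_weight u * sqrt 2)" using pos by (intro mult_right_mono) auto
      also have "\<dots> = 2 * sqrt 2 * height_weight u" by simp
      finally show ?thesis .
    qed
  qed
qed

section \<open>Covers with lamps on three remote edges\<close>

lemma card_image_le_if_factors:
  assumes "finite (g ` A)" "\<And>x y. x \<in> A \<Longrightarrow> y \<in> A \<Longrightarrow> g x = g y \<Longrightarrow> f x = f y"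
  shows "card (f ` A) \<le> card (g ` A)"
proof -
  have "f ` A = (\<lambda>z. f (SOME x. x \<in> A \<and> g x = z)) ` (g ` A)"
    unfolding image_image
  proof (rule image_cong[OF refl])
    fix x assume "x \<in> A"
    then have "\<exists>y. y \<in> A \<and> g y = g x" by blast
    from someI_ex[OF this] show "f x = f (SOME y. y \<in> A \<and> g y = g x)"
      using assms(2)[OF \<open>x \<in> A\<close>] by metis
  qed
  then show ?thesis using assms(1) card_image_le by metis
qed

lemma concat_inj_on_equal_length:
  assumes "concat xss = concat yss" "length xss = length yss"
    "\<forall>xs\<in>set xss. length xs = n" "\<forall>ys\<in>set yss. length ys = n"
  shows "xss = yss"
  using assms(2,1,3,4) by (induction rule: list_induct2) auto

locale lamps = marked_group +
  fixes g :: "nat \<Rightarrow> 'a" and s0 :: 'a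
  assumes s0: "s0 \<in> S" and g_closed: "\<And>i. i < 3 \<Longrightarrow> g i \<in> carrier G"
begin

definition edge :: "nat \<Rightarrow> 'a set" where "edge i = {g i, s0 \<otimes> g i}"

text \<open>The value 3 stands for an edge without lamp; as \<open>toggle 3\<close> is the identity,
  plain edges need no case of their own.\<close>

definition idx :: "'a set \<Rightarrow> nat" where
  "idx e = (if e = edge 0 then 0 else if e = edge 1 then 1 else if e = edge 2 then 2 else 3)"

text \<open>Edges are unordered pairs, so that going back along an edge meets the same lamp and
  undoes its toggle. Points outside the carrier are fixed to obtain permutations of the whole
  type.\<close>

definition lamp :: "'a \<Rightarrow> 'a \<times> nat list \<Rightarrow> 'a \<times> nat list" where
  "lamp s y = (if fst y \<in> carrier G
     then (s \<otimes> fst y, toggle (idx {fst y, s \<otimes> fst y}) (snd y)) else y)"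

definition letters :: "('a \<times> nat list \<Rightarrow> 'a \<times> nat list) set" where "letters = lamp ` S"

abbreviation lamp_group :: "('a \<times> nat list \<Rightarrow> 'a \<times> nat list) monoid" where
  "lamp_group \<equiv> perm_group letters"

definition act :: "'a list \<Rightarrow> 'a \<times> nat list \<Rightarrow> 'a \<times> nat list" where
  "act w = foldr (\<circ>) (map lamp w) id"

lemma act_Nil [simp]: "act [] = id" and act_Cons: "act (s # w) y = lamp s (act w y)"
  and act_append: "act (v @ w) y = act v (act w y)"
  by (simp_all add: act_def foldr_comp_append del: foldr_append)

lemma S_closed: "s \<in> S \<Longrightarrow> s \<in> carrier G" using sub by blast

lemma lamp_inverse:
  assumes "s \<in> S"
  shows "lamp (inv s) (lamp s y) = y"
proof (cases "fst y \<in> carrier G")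
  case True
  then have "inv s \<otimes> (s \<otimes> fst y) = fst y"
    using S_closed[OF assms] by (simp add: m_assoc[symmetric])
  then show ?thesis using True S_closed[OF assms] by (simp add: lamp_def insert_commute)
qed (simp add: lamp_def)

lemma lamp_inverse': "s \<in> S \<Longrightarrow> lamp s (lamp (inv s) y) = y"
  using lamp_inverse[of "inv s" y] inv_S S_closed by simp

sublocale lamp: marked_group lamp_group letters
proof (rule marked_perm_group)
  show "finite letters" using fin by (simp add: letters_def)
  fix t assume "t \<in> letters"
  then obtain s where "s \<in> S" "t = lamp s" by (auto simp: letters_def)
  then show "\<exists>t'\<in>letters. t' \<circ> t = id"
    using inv_S by (intro bexI[of _ "lamp (inv s)"]) (auto simp: letters_def lamp_inverse)
qed

lemma inj_lamp: "inj_on lamp S"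
proof (rule inj_onI)
  fix s t assume "s \<in> S" "t \<in> S" "lamp s = lamp t"
  then have "fst (lamp s (\<one>, [])) = fst (lamp t (\<one>, []))" by simp
  then show "s = t" using \<open>s \<in> S\<close> \<open>t \<in> S\<close> S_closed by (simp add: lamp_def)
qed

lemma card_letters: "card letters = card S"
  unfolding letters_def by (rule card_image[OF inj_lamp])

lemma fst_act:
  assumes "set w \<subseteq> S" "fst y \<in> carrier G"
  shows "fst (act w y) = word_val G w \<otimes> fst y"
  using assms
proof (induction w)
  case (Cons s w)
  then show ?case
    using word_closed[of w] S_closed[of s] by (simp add: act_Cons lamp_def m_assoc)
qed simp

lemma act_outside: "fst y \<notin> carrier G \<Longrightarrow> act w y = y"
  by (induction w) (auto simp: act_Cons lamp_def)

lemma distinct_adj_act: "distinct_adj (snd (act w y)) \<longleftrightarrow> distinct_adj (snd y)"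
  by (induction w) (auto simp: act_Cons lamp_def)

lemma act_inverse:
  assumes "set w \<subseteq> S"
  shows "act (map (m_inv G) (rev w)) (act w y) = y"
  using assms by (induction w) (auto simp: act_append act_Cons lamp_inverse)

fun crossed :: "'a list \<Rightarrow> 'a \<Rightarrow> nat set" where
  "crossed [] x = {}"
| "crossed (s # w) x = insert (idx {word_val G w \<otimes> x, s \<otimes> (word_val G w \<otimes> x)}) (crossed w x)"

lemma crossed_append:
  assumes "set v \<subseteq> S" "set w \<subseteq> S" "x \<in> carrier G"
  shows "crossed (v @ w) x = crossed v (word_val G w \<otimes> x) \<union> crossed w x"
  using assms
  by (induction v) (auto simp: word_append word_closed m_assoc simp del: foldr_append)

lemma crossed_le_3: "i \<in> crossed w x \<Longrightarrow> i \<le> 3"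
proof (induction w)
  case (Cons s w)
  have "idx e \<le> 3" for e by (simp add: idx_def)
  with Cons show ?case by (auto simp del: One_nat_def)
qed simp

lemma idx_less_3: "idx e = i \<Longrightarrow> i < 3 \<Longrightarrow> e = edge i"
  unfolding idx_def by (metis less_irrefl)

text \<open>The exponent is chosen before \<open>u\<close>: the whole fibre over \<open>x\<close> is
  moved by one and the same power of \<open>toggle j\<close>.\<close>

lemma act_single_lamp:
  assumes "set w \<subseteq> S" "x \<in> carrier G" "crossed w x \<subseteq> {j, 3}"
  shows "\<exists>n. \<forall>u. act w (x, u) = (word_val G w \<otimes> x, (toggle j ^^ n) u)"
  using assms
proof (induction w)
  case Nil
  show ?case using Nil by (intro exI[of _ 0]) simp
next
  case (Cons s w)
  then obtain n where n: "\<And>u. act w (x, u) = (word_val G w \<otimes> x, (toggle j ^^ n) u)" by auto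
  let ?p = "word_val G w \<otimes> x"
  have p: "?p \<in> carrier G" "s \<otimes> ?p = word_val G (s # w) \<otimes> x"
    using Cons.prems word_closed[of w] S_closed[of s] by (auto simp: m_assoc)
  have "idx {?p, s \<otimes> ?p} = j \<or> idx {?p, s \<otimes> ?p} = 3" using Cons.prems by auto
  then show ?case
  proof
    assume "idx {?p, s \<otimes> ?p} = j"
    then have "\<forall>u. act (s # w) (x, u) = (word_val G (s # w) \<otimes> x, (toggle j ^^ Suc n) u)"
      using n p by (simp add: act_Cons lamp_def)
    then show ?thesis by blast
  next
    assume "idx {?p, s \<otimes> ?p} = 3"
    then have "\<forall>u. act (s # w) (x, u) = (word_val G (s # w) \<otimes> x, (toggle j ^^ n) u)"
      using n p by (simp add: act_Cons lamp_def)
    then show ?thesis by blast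
  qed
qed

lemma crossed_split:
  "i \<in> crossed w x \<Longrightarrow>
    \<exists>u t v. w = u @ t # v \<and> i = idx {word_val G v \<otimes> x, t \<otimes> (word_val G v \<otimes> x)}"
proof (induction w)
  case (Cons s w)
  then consider "i = idx {word_val G w \<otimes> x, s \<otimes> (word_val G w \<otimes> x)}" | "i \<in> crossed w x" by auto
  then show ?case
  proof cases
    case 1
    then show ?thesis by (intro exI[of _ "[]"]) auto
  next
    case 2
    then obtain u t v where "w = u @ t # v" "i = idx {word_val G v \<otimes> x, t \<otimes> (word_val G v \<otimes> x)}"
      using Cons.IH by blast
    then show ?thesis by (intro exI[of _ "s # u"]) auto
  qed
qed simp

lemma crossed_reach:
  assumes "set b \<subseteq> S" "x \<in> carrier G" "i \<in> crossed b x" "i < 3"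
  shows "\<exists>v. set v \<subseteq> S \<and> length v \<le> length b \<and> word_val G v \<otimes> x = g i"
proof -
  obtain u t v where b: "b = u @ t # v" and i: "i = idx {word_val G v \<otimes> x, t \<otimes> (word_val G v \<otimes> x)}"
    using crossed_split[OF assms(3)] by blast
  have v: "set v \<subseteq> S" "t \<in> S" using b assms(1) by auto
  have "edge i = {word_val G v \<otimes> x, t \<otimes> (word_val G v \<otimes> x)}"
    using idx_less_3[OF i[symmetric] assms(4)] by simp
  then have "g i \<in> {word_val G v \<otimes> x, t \<otimes> (word_val G v \<otimes> x)}" by (auto simp: edge_def)
  then consider "g i = word_val G v \<otimes> x" | "g i = word_val G (t # v) \<otimes> x"
    using v word_closed[of v] S_closed[of t] assms(2) by (auto simp: m_assoc)
  then show ?thesis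
  proof cases
    case 1
    then show ?thesis using v b by (intro exI[of _ v]) auto
  next
    case 2
    then show ?thesis using v b by (intro exI[of _ "t # v"]) auto
  qed
qed

end

text \<open>\<open>w' @ [s0]\<close> is a loop whose first step, by \<open>s0\<close>, follows the
  edge that is to carry a lamp; by \<open>simple\<close>, the rest never crosses that edge again in
  either direction. The distance \<open>2 * r\<close> ensures that walks of length at most
  \<open>r\<close> from one point meet at most one lamp.\<close>

locale remote_lamps = lamps +
  fixes r :: nat and w' :: "'a list"
  assumes r: "Suc (length w') \<le> r"
    and remote: "\<And>i j w. i < 3 \<Longrightarrow> j < 3 \<Longrightarrow> i \<noteq> j \<Longrightarrow> set w \<subseteq> S \<Longrightarrow> length w \<le> 2 * r \<Longrightarrow>
      word_val G w \<otimes> g i \<noteq> g j"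
    and w': "set w' \<subseteq> S" and loop: "word_val G (w' @ [s0]) = \<one>"
    and simple: "\<And>u t v. w' = u @ t # v \<Longrightarrow>
      {word_val G (v @ [s0]), t \<otimes> word_val G (v @ [s0])} \<noteq> {\<one>, s0}"
begin

lemma crossed_unique:
  assumes "set b \<subseteq> S" "set b' \<subseteq> S" "length b \<le> r" "length b' \<le> r" "x \<in> carrier G"
    "i \<in> crossed b x" "i' \<in> crossed b' x" "i < 3" "i' < 3"
  shows "i = i'"
proof (rule ccontr)
  assume "i \<noteq> i'"
  obtain v where v: "set v \<subseteq> S" "length v \<le> r" "word_val G v \<otimes> x = g i"
    using crossed_reach[of b x i] assms by auto
  obtain v' where v': "set v' \<subseteq> S" "length v' \<le> r" "word_val G v' \<otimes> x = g i'"
    using crossed_reach[of b' x i'] assms by auto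
  \<comment> \<open>The walk from \<open>g i\<close> back to \<open>x\<close> and on to
    \<open>g i'\<close>, of length at most \<open>2 * r\<close>.\<close>
  let ?w = "v' @ map (m_inv G) (rev v)"
  have "word_val G ?w \<otimes> g i = word_val G v' \<otimes> (inv (word_val G v) \<otimes> (word_val G v \<otimes> x))"
    unfolding word_append[OF v'(1) set_word_inverse[OF v(1)]] word_inverse[OF v(1)] v(3)[symmetric]
    using word_closed[OF v(1)] word_closed[OF v'(1)] assms(5) by (simp add: m_assoc)
  also have "inv (word_val G v) \<otimes> (word_val G v \<otimes> x) = x"
    using word_closed[OF v(1)] assms(5) by (simp add: m_assoc[symmetric])
  finally have "word_val G ?w \<otimes> g i = g i'" using v' by simp
  moreover have "set ?w \<subseteq> S" using v v' set_word_inverse[OF v(1)] by auto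
  ultimately show False using remote[of i i' ?w] \<open>i \<noteq> i'\<close> assms v v' by auto
qed

lemma crossed_single:
  assumes "x \<in> carrier G"
  shows "\<exists>j. \<forall>b. set b \<subseteq> S \<longrightarrow> length b \<le> r \<longrightarrow> crossed b x \<subseteq> {j, 3}"
proof (cases "\<exists>b i. set b \<subseteq> S \<and> length b \<le> r \<and> i \<in> crossed b x \<and> i < 3")
  case True
  then obtain b i where b: "set b \<subseteq> S" "length b \<le> r" "i \<in> crossed b x" "i < 3" by blast
  have "crossed b' x \<subseteq> {i, 3}" if "set b' \<subseteq> S" "length b' \<le> r" for b'
  proof
    fix i' assume "i' \<in> crossed b' x"
    then show "i' \<in> {i, 3}"
      using crossed_unique[of b b' x i i'] crossed_le_3[of i' b' x] b that assms
      by (cases "i' < 3") auto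
  qed
  then show ?thesis by blast
next
  case False
  have "crossed b x \<subseteq> {3, 3}" if "set b \<subseteq> S" "length b \<le> r" for b
    using False that crossed_le_3[of _ b x] by (force simp: le_less)
  then show ?thesis by blast
qed

lemma idx_edge:
  assumes "j < 3"
  shows "idx (edge j) = j"
proof -
  have ne: "edge i \<noteq> edge j" if "i < 3" "i \<noteq> j" for i
  proof
    assume "edge i = edge j"
    then have "g j = g i \<or> g j = s0 \<otimes> g i" unfolding edge_def by blast
    then show False
      using remote[of i j "[]"] remote[of i j "[s0]"] that assms r s0 g_closed[of i] S_closed[OF s0]
      by auto
  qed
  have "j = 0 \<or> j = 1 \<or> j = 2" using assms by auto
  then show ?thesis using ne[of 0] ne[of 1] ne[of 2] by (auto simp: idx_def)
qed

text \<open>The translate of the loop to \<open>g j\<close> is too short to reach another lamp, and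
  it crosses its own lamp edge only in its first step, so \<open>w'\<close> changes no
  state.\<close>

lemma loop_act:
  assumes "j < 3"
  shows "act w' (s0 \<otimes> g j, u) = (g j, u)" "act [s0] (g j, u) = (s0 \<otimes> g j, toggle j u)"
proof -
  note gj = g_closed[OF assms] and s0c = S_closed[OF s0]
  show s0_act: "act [s0] (g j, u) = (s0 \<otimes> g j, toggle j u)"
    using gj idx_edge[OF assms] by (simp add: act_Cons lamp_def edge_def)
  have app: "crossed (w' @ [s0]) (g j) = crossed w' (s0 \<otimes> g j) \<union> {j}"
    using crossed_append[of w' "[s0]" "g j"] w' s0 gj s0c idx_edge[OF assms] by (simp add: edge_def)
  have "crossed w' (s0 \<otimes> g j) \<subseteq> {3, 3}"
  proof
    fix i assume i: "i \<in> crossed w' (s0 \<otimes> g j)"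
    show "i \<in> {3, 3}"
    proof (cases "i < 3")
      case True
      have "i = j"
        using crossed_unique[of "w' @ [s0]" "w' @ [s0]" "g j" i j] app i True w' s0 r gj assms by auto
      obtain u t v where split: "w' = u @ t # v"
        and idx: "i = idx {word_val G v \<otimes> (s0 \<otimes> g j), t \<otimes> (word_val G v \<otimes> (s0 \<otimes> g j))}"
        using crossed_split[OF i] by blast
      have vt: "set v \<subseteq> S" "t \<in> S" using split w' by auto
      let ?q = "word_val G (v @ [s0])"
      have q: "?q \<in> carrier G" "word_val G v \<otimes> (s0 \<otimes> g j) = ?q \<otimes> g j"
        using vt s0 word_closed[of "v @ [s0]"] word_closed[of v] s0c gj
        by (auto simp: word_append m_assoc simp del: foldr_append)
      \<comment> \<open>Right translation by \<open>g j\<close> commutes with the letters, so a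
        second crossing of the lamp edge would be one of the edge from \<one> to \<open>s0\<close>
        in the original loop.\<close>
      have "{?q \<otimes> g j, t \<otimes> ?q \<otimes> g j} = {\<one> \<otimes> g j, s0 \<otimes> g j}"
        using idx_less_3[OF idx[symmetric] True] q vt S_closed gj \<open>i = j\<close>
        by (simp add: edge_def m_assoc)
      then have "(\<lambda>x. x \<otimes> g j) ` {?q, t \<otimes> ?q} = (\<lambda>x. x \<otimes> g j) ` {\<one>, s0}" by simp
      moreover have "inj_on (\<lambda>x. x \<otimes> g j) (carrier G)"
        using gj by (intro inj_onI) simp
      ultimately have "{?q, t \<otimes> ?q} = {\<one>, s0}"
        using q vt S_closed s0c by (subst (asm) inj_on_image_eq_iff) auto
      with simple[OF split] show ?thesis by simp
    next
      case False
      then show ?thesis using crossed_le_3[OF i] by simp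
    qed
  qed
  then obtain n where "\<And>u. act w' (s0 \<otimes> g j, u) = (word_val G w' \<otimes> (s0 \<otimes> g j), (toggle 3 ^^ n) u)"
    using act_single_lamp[of w' "s0 \<otimes> g j" 3] w' s0c gj by auto
  moreover have "word_val G w' \<otimes> (s0 \<otimes> g j) = g j"
    using loop word_append[of w' "[s0]"] w' s0 s0c gj word_closed[OF w']
    by (simp add: m_assoc[symmetric] del: foldr_append)
  moreover have "(toggle 3 ^^ n) u = u" for u by (induction n) auto
  ultimately show "act w' (s0 \<otimes> g j, u) = (g j, u)" by simp
qed

text \<open>Crossing a lamp edge can be replaced by the way round the translated loop, which does not
  meet any lamp.\<close>

lemma lamp_free_path:
  assumes "x \<in> carrier G"
  shows "\<exists>v. set v \<subseteq> S \<and> (\<forall>u. act v (\<one>, u) = (x, u))"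
proof -
  obtain w where w: "set w \<subseteq> S" "word_val G w = x" using word_surj[OF assms] by blast
  have "\<exists>v. set v \<subseteq> S \<and> (\<forall>u. act v (\<one>, u) = (word_val G w, u))" using w(1)
  proof (induction w)
    case Nil
    then show ?case by (intro exI[of _ "[]"]) simp
  next
    case (Cons t w)
    let ?p = "word_val G w"
    obtain v where v: "set v \<subseteq> S" "\<And>u. act v (\<one>, u) = (?p, u)" using Cons by auto
    have p: "?p \<in> carrier G" and t: "t \<in> S" using Cons.prems word_closed[of w] by auto
    show ?case
    proof (cases "idx {?p, t \<otimes> ?p} < 3")
      case False
      then show ?thesis
        using v t p by (intro exI[of _ "t # v"]) (auto simp: act_Cons lamp_def)
    next
      case True
      define i where "i = idx {?p, t \<otimes> ?p}"
      have i: "i < 3" "{?p, t \<otimes> ?p} = edge i" using True idx_less_3 by (auto simp: i_def)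
      then consider "?p = g i" "t \<otimes> ?p = s0 \<otimes> g i" | "?p = s0 \<otimes> g i" "t \<otimes> ?p = g i"
        by (auto simp: edge_def doubleton_eq_iff)
      then show ?thesis
      proof cases
        case 1
        have "act (map (m_inv G) (rev w')) (g i, u) = (s0 \<otimes> g i, u)" for u
          using act_inverse[OF w', of "(s0 \<otimes> g i, u)"] loop_act[OF i(1)] by simp
        then show ?thesis
          using 1 v set_word_inverse[OF w']
          by (intro exI[of _ "map (m_inv G) (rev w') @ v"]) (auto simp: act_append)
      next
        case 2
        then show ?thesis
          using v w' loop_act[OF i(1)] by (intro exI[of _ "w' @ v"]) (auto simp: act_append)
      qed
    qed
  qed
  with w show ?thesis by simp
qed

lemma act_padding: "act (concat (replicate p [s0, inv s0])) y = y"
  by (induction p) (auto simp: act_append act_Cons lamp_inverse' s0)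

text \<open>Walk from \<one> to \<open>g j\<close> without changing states, go once round the loop
  there, and walk back.\<close>

lemma kernel_words_exist:
  "\<exists>L>0. \<exists>\<kappa>. \<forall>j<3. set (\<kappa> j) \<subseteq> S \<and> length (\<kappa> j) = L \<and> (\<forall>u. act (\<kappa> j) (\<one>, u) = (\<one>, toggle j u))"
proof -
  have "\<forall>j. \<exists>v. j < 3 \<longrightarrow> set v \<subseteq> S \<and> (\<forall>u. act v (\<one>, u) = (g j, u))"
    using lamp_free_path g_closed by blast
  then obtain v where v: "\<And>j. j < 3 \<Longrightarrow> set (v j) \<subseteq> S" "\<And>j u. j < 3 \<Longrightarrow> act (v j) (\<one>, u) = (g j, u)"
    by metis
  \<comment> \<open>A common upper bound for the lengths. Each letter missing from
    \<open>v j\<close> saves two letters in the conjugate, which one pair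
    \<open>[s0, inv s0]\<close> makes up for.\<close>
  define m where "m = (\<Sum>j<3. length (v j))"
  define \<kappa> where "\<kappa> j = map (m_inv G) (rev (v j)) @ w' @ [s0] @ v j
    @ concat (replicate (m - length (v j)) [s0, inv s0])" for j
  have "set (\<kappa> j) \<subseteq> S \<and> length (\<kappa> j) = Suc (length w') + 2 * m
      \<and> (\<forall>u. act (\<kappa> j) (\<one>, u) = (\<one>, toggle j u))" if j: "j < 3" for j
  proof (intro conjI allI)
    show "set (\<kappa> j) \<subseteq> S"
      using set_word_inverse[OF v(1)[OF j]] w' s0 inv_S[OF s0] v(1)[OF j] by (auto simp: \<kappa>_def)
    have "length (v j) \<le> m" unfolding m_def using j by (intro member_le_sum) auto
    moreover have "length (concat (replicate p [s0, inv s0])) = 2 * p" for p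
      by (induction p) auto
    ultimately show "length (\<kappa> j) = Suc (length w') + 2 * m"
      by (simp add: \<kappa>_def del: length_concat)
    fix u
    have "act (map (m_inv G) (rev (v j))) (g j, toggle j u) = (\<one>, toggle j u)"
      using act_inverse[OF v(1)[OF j], of "(\<one>, toggle j u)"] v(2)[OF j] by simp
    then show "act (\<kappa> j) (\<one>, u) = (\<one>, toggle j u)"
      unfolding \<kappa>_def by (simp only: act_append act_padding v(2)[OF j] loop_act[OF j])
  qed
  then show ?thesis by (intro exI[of _ "Suc (length w') + 2 * m"]) auto
qed

end

context lamps
begin

lemma word_val_lamp: "word_val lamp_group (map lamp w) = act w"
  by (simp add: act_def)

lemma card_identity_words_lamp:
  "card {w. set w \<subseteq> letters \<and> length w = n \<and> P w} = card {w. set w \<subseteq> S \<and> length w = n \<and> P (map lamp w)}"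
proof -
  have "{w. set w \<subseteq> letters \<and> length w = n \<and> P w} = map lamp ` {w. set w \<subseteq> S \<and> length w = n \<and> P (map lamp w)}"
    (is "?L = ?R")
  proof (intro equalityI subsetI)
    fix w assume w: "w \<in> ?L"
    then have "w \<in> lists (lamp ` S)" by (auto simp: letters_def)
    then obtain v where "v \<in> lists S" "w = map lamp v" unfolding lists_image by blast
    then show "w \<in> ?R" using w by (intro image_eqI[of _ _ v]) auto
  qed (auto simp: letters_def subset_iff)
  moreover have "inj_on (map lamp) {w. set w \<subseteq> S \<and> length w = n \<and> P (map lamp w)}"
    by (rule inj_on_subset[OF inj_on_map_lists[OF inj_lamp]]) auto
  ultimately show ?thesis by (simp add: card_image)
qed

end

section \<open>Growth of the cover: nearly that of the group, and strictly smaller\<close>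

context remote_lamps
begin

text \<open>Short closed words act as commuting involutions, so only the parities of their
  multiplicities matter.\<close>

lemma act_concat_parity:
  assumes "n \<le> r" "set bs \<subseteq> identity_words G S n" "set bs' \<subseteq> identity_words G S n"
    and par: "{b \<in> identity_words G S n. odd (count_list bs b)} = {b \<in> identity_words G S n. odd (count_list bs' b)}"
  shows "act (concat bs) = act (concat bs')"
proof (rule ext)
  fix y :: "'a \<times> nat list"
  obtain x u where y: "y = (x, u)" by (cases y)
  show "act (concat bs) y = act (concat bs') y"
  proof (cases "x \<in> carrier G")
    case False
    then show ?thesis by (simp add: y act_outside)
  next
    case True
    let ?C = "identity_words G S n"
    obtain j where j: "\<And>b. set b \<subseteq> S \<Longrightarrow> length b \<le> r \<Longrightarrow> crossed b x \<subseteq> {j, 3}"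
      using crossed_single[OF True] by blast
    have "\<exists>m. \<forall>u. act b (x, u) = (x, (toggle j ^^ m) u)" if "b \<in> ?C" for b
      using act_single_lamp[OF _ True j, of b] that assms(1) True by (auto simp: identity_words_def)
    then obtain m where m: "\<And>b u. b \<in> ?C \<Longrightarrow> act b (x, u) = (x, (toggle j ^^ m b) u)" by metis
    have cat: "act (concat cs) (x, u) = (x, (toggle j ^^ (\<Sum>b\<in>?C. count_list cs b * m b)) u)"
      if "set cs \<subseteq> ?C" for cs
    proof -
      have "act (concat cs) (x, u) = (x, (toggle j ^^ sum_list (map m cs)) u)" using that
        by (induction cs) (auto simp: act_append m funpow_add)
      then show ?thesis
        using sum_list_map_eq_sum_count2[OF that finite_identity_words[OF fin], of m] by simp
    qed
    have ev: "(toggle j ^^ (p + 2 * q)) u = (toggle j ^^ p) u" for p q u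
      by (simp add: funpow_add toggle_funpow_even del: funpow.simps)
    have toggle_parity: "(toggle j ^^ p) u = (toggle j ^^ (p mod 2)) u" for p u
      using ev[of "p mod 2" "p div 2"] by simp
    have "count_list bs b * m b mod 2 = count_list bs' b * m b mod 2" if "b \<in> ?C" for b
    proof -
      from that have  "odd (count_list bs b) \<longleftrightarrow> odd (count_list bs' b)" using par by blast
      then have "odd (count_list bs b * m b) \<longleftrightarrow> odd (count_list bs' b * m b)" by simp
      then show "count_list bs b * m b mod 2 = count_list bs' b * m b mod 2"
        by (metis mod2_eq_if)
    qed
    then have "(\<Sum>b\<in>?C. count_list bs b * m b) mod 2 = (\<Sum>b\<in>?C. count_list bs' b * m b) mod 2"
      by (subst (1 2) mod_sum_eq[symmetric]) simp
    then have "act (concat bs) (x, u) = act (concat bs') (x, u)"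
      unfolding cat[OF assms(2)] cat[OF assms(3)]
      by (subst (1 2) toggle_parity) simp
    then show ?thesis by (simp add: y)
  qed
qed

text \<open>Products of m closed words of length \<open>n\<close> take at most 2^c(n) values in the
  cover, one for each parity pattern, while there are c(n)^m of them. Letting m grow in
  \<open>card_words_le_growth\<close> removes the constant.\<close>

lemma identity_words_le_lamp_growth:
  assumes "n \<le> r"
  shows "real (card (identity_words G S n)) \<le> lamp.growth ^ n"
proof (rule le_if_power_le_const)
  let ?C = "identity_words G S n"
  show "0 \<le> lamp.growth ^ n" using lamp.growth_nonneg by simp
  fix m
  define D where "D = {bs. set bs \<subseteq> ?C \<and> length bs = m}"
  define A where "A = (\<lambda>bs. map lamp (concat bs)) ` D"
  have finC: "finite ?C" by (rule finite_identity_words[OF fin])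
  have D_S: "set (concat bs) \<subseteq> S" "length (concat bs) = n * m" if "bs \<in> D" for bs
  proof -
    have "\<forall>b\<in>set bs. set b \<subseteq> S \<and> length b = n" "length bs = m"
      using that by (auto simp: D_def identity_words_def)
    then show "set (concat bs) \<subseteq> S" "length (concat bs) = n * m"
      by (induction bs arbitrary: m) auto
  qed
  have "inj_on (\<lambda>bs. map lamp (concat bs)) D"
  proof (rule inj_onI)
    fix bs cs assume bc: "bs \<in> D" "cs \<in> D" "map lamp (concat bs) = map lamp (concat cs)"
    have "concat bs = concat cs"
      using D_S(1)[OF bc(1)] D_S(1)[OF bc(2)]
      by (intro map_inj_on[OF bc(3)] inj_on_subset[OF inj_lamp] Un_least)
    then show "bs = cs"
      using bc(1,2) by (intro concat_inj_on_equal_length[of bs cs n]) (auto simp: D_def identity_words_def)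
  qed
  then have "card A = card D" unfolding A_def by (rule card_image)
  also have "\<dots> = card ?C ^ m" unfolding D_def by (rule card_lists_length_eq[OF finC])
  finally have cardA: "card A = card ?C ^ m" .
  have "card (word_val lamp_group ` A) \<le> 2 ^ card ?C"
  proof -
    let ?par = "\<lambda>bs. {b \<in> ?C. odd (count_list bs b)}"
    have "word_val lamp_group ` A = (\<lambda>bs. act (concat bs)) ` D"
      unfolding A_def image_image word_val_lamp ..
    also have "card \<dots> \<le> card (?par ` D)"
    proof (rule card_image_le_if_factors)
      show "finite (?par ` D)" by (rule finite_subset[of _ "Pow ?C"]) (use finC in auto)
    qed (auto simp: D_def intro!: act_concat_parity[OF assms])
    also have "\<dots> \<le> card (Pow ?C)" using finC by (intro card_mono) auto
    finally show ?thesis using finC by (simp add: card_Pow)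
  qed
  moreover have "A \<subseteq> {w. set w \<subseteq> letters \<and> length w = n * m}"
  proof
    fix w assume "w \<in> A"
    then obtain bs where "bs \<in> D" "w = map lamp (concat bs)" by (auto simp: A_def)
    then show "w \<in> {w. set w \<subseteq> letters \<and> length w = n * m}"
      using D_S[of bs] by (auto simp: letters_def simp del: set_concat length_concat)
  qed
  moreover have "card letters > 0" using card_letters s0 fin by (simp add: card_gt_0_iff) auto
  ultimately have "real (card A) \<le> real (2 ^ card ?C) * lamp.growth ^ (n * m)"
    by (intro lamp.card_words_le_growth)
  then show "real (card ?C) ^ m \<le> real (2 ^ card ?C) * (lamp.growth ^ n) ^ m"
    by (simp add: cardA power_mult)
qed

lemma lamp_growth_less: "lamp.growth < growth"
proof -
  obtain L \<kappa> where L: "L > 0"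
    and \<kappa>: "\<And>j. j < 3 \<Longrightarrow> set (\<kappa> j) \<subseteq> S" "\<And>j. j < 3 \<Longrightarrow> length (\<kappa> j) = L"
      "\<And>j u. j < 3 \<Longrightarrow> act (\<kappa> j) (\<one>, u) = (\<one>, toggle j u)"
    using kernel_words_exist by blast
  define \<phi> :: "('a \<times> nat list \<Rightarrow> 'a \<times> nat list) \<Rightarrow> 'a" where "\<phi> \<gamma> = fst (\<gamma> (\<one>, []))" for \<gamma>
  \<comment> \<open>Evaluating at a point over \<open>inv (\<phi> \<gamma>)\<close> makes
    \<open>\<gamma>\<close> land over \<one>, the fibre on which \<open>\<kappa> j\<close> is known
    to act as \<open>toggle j\<close>. Composing with \<open>act (\<kappa> j)\<close> is then one
    step on the 3-regular tree.\<close>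
  define h where "h \<gamma> = height_weight (snd (\<gamma> (inv (\<phi> \<gamma>), [])))" for \<gamma>
  define Q where "Q = (\<lambda>j. map lamp (\<kappa> j)) ` {..<3}"
  let ?\<Gamma> = "lamp_group"
  have act_ex: "\<exists>w. set w \<subseteq> S \<and> \<gamma> = act w" if \<gamma>: "\<gamma> \<in> carrier ?\<Gamma>" for \<gamma>
  proof -
    obtain v where v: "set v \<subseteq> letters" "\<gamma> = word_val ?\<Gamma> v" using lamp.word_surj[OF \<gamma>] by blast
    then have "v \<in> lists (lamp ` S)" by (auto simp: letters_def)
    then obtain w where "w \<in> lists S" "v = map lamp w" unfolding lists_image by blast
    then show ?thesis using v word_val_lamp[of w] by (intro exI[of _ w]) auto
  qed
  have act_mem: "act w \<in> carrier ?\<Gamma>" if "set w \<subseteq> S" for w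
    using that lamp.word_closed[of "map lamp w"] word_val_lamp[of w] by (auto simp: letters_def)
  have \<phi>_act: "\<phi> (act w) = word_val G w" if "set w \<subseteq> S" for w
    using fst_act[OF that, of "(\<one>, [])"] word_closed[OF that] by (simp add: \<phi>_def)
  have \<phi>_closed: "\<phi> \<gamma> \<in> carrier G" and fst_\<gamma>: "x \<in> carrier G \<Longrightarrow> fst (\<gamma> (x, u)) = \<phi> \<gamma> \<otimes> x"
    and adj_\<gamma>: "distinct_adj (snd (\<gamma> (x, u))) = distinct_adj u"
    if "\<gamma> \<in> carrier ?\<Gamma>" for \<gamma> x u
    using act_ex[OF that] \<phi>_act word_closed fst_act distinct_adj_act by auto
  have hom: "\<phi> \<in> hom ?\<Gamma> G"
  proof (rule homI)
    fix \<gamma> \<gamma>' assume g: "\<gamma> \<in> carrier ?\<Gamma>" "\<gamma>' \<in> carrier ?\<Gamma>"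
    have "\<phi> (\<gamma> \<circ> \<gamma>') = fst (\<gamma> (\<phi> \<gamma>', snd (\<gamma>' (\<one>, []))))" by (simp add: \<phi>_def)
    also have "\<dots> = \<phi> \<gamma> \<otimes> \<phi> \<gamma>'" using fst_\<gamma>[OF g(1)] \<phi>_closed[OF g(2)] by simp
    finally show "\<phi> (\<gamma> \<otimes>\<^bsub>?\<Gamma>\<^esub> \<gamma>') = \<phi> \<gamma> \<otimes> \<phi> \<gamma>'" by simp
  qed (rule \<phi>_closed)
  interpret hom: group_hom ?\<Gamma> G \<phi>
    using hom by (simp add: group_hom_def group_hom_axioms_def lamp.is_group is_group)
  have \<kappa>_val: "word_val G (\<kappa> j) = \<one>" if "j < 3" for j
    using fst_act[OF \<kappa>(1)[OF that], of "(\<one>, [])"] \<kappa>(3)[OF that] word_closed[OF \<kappa>(1)[OF that]] by simp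
  have \<phi>_lamp: "map \<phi> (map lamp w) = w" if "set w \<subseteq> S" for w
    using that S_closed by (induction w) (auto simp: \<phi>_def lamp_def)
  have inj: "inj_on (\<lambda>j. map lamp (\<kappa> j)) {..<3}"
  proof (rule inj_onI)
    fix i j :: nat assume ij: "i \<in> {..<3}" "j \<in> {..<3}" "map lamp (\<kappa> i) = map lamp (\<kappa> j)"
    then have "act (\<kappa> i) (\<one>, []) = act (\<kappa> j) (\<one>, [])" by (simp add: act_def)
    then show "i = j" using ij \<kappa>(3) by (simp add: toggle_def)
  qed
  have cardQ: "card Q = 3" unfolding Q_def using card_image[OF inj] by simp
  have sumQ: "(\<Sum>w\<in>Q. F (word_val ?\<Gamma> w)) = (\<Sum>j<3. F (act (\<kappa> j)))" for F :: "_ \<Rightarrow> real"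
    unfolding Q_def by (subst sum.reindex[OF inj]) (simp only: o_def word_val_lamp)
  have fibre: "\<exists>u. distinct_adj u \<and> \<gamma> (inv (\<phi> \<gamma>), []) = (\<one>, u)" if that: "\<gamma> \<in> carrier ?\<Gamma>" for \<gamma>
  proof -
    have "fst (\<gamma> (inv (\<phi> \<gamma>), [])) = \<one>" using fst_\<gamma>[OF that] \<phi>_closed[OF that] by simp
    moreover have "distinct_adj (snd (\<gamma> (inv (\<phi> \<gamma>), [])))" using adj_\<gamma>[OF that] by simp
    ultimately show ?thesis by (intro exI[of _ "snd (\<gamma> (inv (\<phi> \<gamma>), []))"]) (simp add: prod_eq_iff)
  qed
  have super: "(\<Sum>j<3. h (\<tau> j \<circ> \<gamma>)) \<le> 2 * sqrt 2 * h \<gamma>"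
    if \<gamma>: "\<gamma> \<in> carrier ?\<Gamma>" and \<tau>: "\<And>j. j < 3 \<Longrightarrow> \<phi> (\<tau> j \<circ> \<gamma>) = \<phi> \<gamma>"
      "\<And>j u. j < 3 \<Longrightarrow> \<tau> j (\<one>, u) = (\<one>, toggle j u)" for \<gamma> and \<tau> :: "nat \<Rightarrow> _"
  proof -
    obtain u where u: "distinct_adj u" "\<gamma> (inv (\<phi> \<gamma>), []) = (\<one>, u)" using fibre[OF \<gamma>] by blast
    have "(\<Sum>j<3. h (\<tau> j \<circ> \<gamma>)) = (\<Sum>j<3. height_weight (toggle j u))"
      using \<tau> u by (intro sum.cong) (auto simp: h_def)
    also have "\<dots> \<le> 2 * sqrt 2 * h \<gamma>" using height_weight_super[OF u(1)] u(2) by (simp add: h_def)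
    finally show ?thesis .
  qed
  have \<kappa>_mem: "act (\<kappa> j) \<in> carrier ?\<Gamma>" "\<phi> (act (\<kappa> j)) = \<one>" if "j < 3" for j
    using act_mem[OF \<kappa>(1)[OF that]] \<phi>_act[OF \<kappa>(1)[OF that]] \<kappa>_val[OF that] by auto
  have Tpos: "card letters > 0" using card_letters s0 fin by (simp add: card_gt_0_iff) auto
  interpret K: kernel_words ?\<Gamma> letters G \<phi> L Q "2 * sqrt 2" h
  proof
    show "\<phi> \<in> hom ?\<Gamma> G" "card letters > 0" "L > 0" by fact+
    show "Q \<subseteq> {w. set w \<subseteq> letters \<and> length w = L}"
    proof
      fix w assume "w \<in> Q"
      then obtain j where j: "j < 3" "w = map lamp (\<kappa> j)" by (auto simp: Q_def)
      then show "w \<in> {w. set w \<subseteq> letters \<and> length w = L}"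
        using image_mono[OF \<kappa>(1)[OF j(1)], of lamp] \<kappa>(2)[OF j(1)] by (simp add: letters_def)
    qed
    show "Q \<noteq> {}" using cardQ by auto
    show "word_val G (map \<phi> w) = \<one>" if w: "w \<in> Q" for w
    proof -
      obtain j where j: "j < 3" "w = map lamp (\<kappa> j)" using w by (auto simp: Q_def)
      show ?thesis unfolding j(2) \<phi>_lamp[OF \<kappa>(1)[OF j(1)]] by (rule \<kappa>_val[OF j(1)])
    qed
    have "(2 * sqrt 2)\<^sup>2 \<le> (3::real)\<^sup>2" by simp
    then have "2 * sqrt 2 \<le> (3::real)" by (rule power2_le_imp_le) simp
    then show "2 * sqrt 2 \<le> real (card Q)" by (simp add: cardQ)
    show "h x > 0" for x by (simp add: h_def height_weight_def)
    show "(\<Sum>w\<in>Q. h (word_val ?\<Gamma> w \<otimes>\<^bsub>?\<Gamma>\<^esub> x)) \<le> 2 * sqrt 2 * h x" if x: "x \<in> carrier ?\<Gamma>" for x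
    proof -
      have "\<phi> (act (\<kappa> j) \<circ> x) = \<phi> x" if "j < 3" for j
        using hom.hom_mult[OF \<kappa>_mem(1)[OF that] x] \<kappa>_mem(2)[OF that] \<phi>_closed[OF x] by simp
      then have "(\<Sum>j<3. h (act (\<kappa> j) \<circ> x)) \<le> 2 * sqrt 2 * h x"
        using \<kappa>(3) by (intro super[OF x]) auto
      then show ?thesis unfolding sumQ[of "\<lambda>\<gamma>. h (\<gamma> \<otimes>\<^bsub>?\<Gamma>\<^esub> x)"] by simp
    qed
    show "(\<Sum>w\<in>Q. h (inv\<^bsub>?\<Gamma>\<^esub> word_val ?\<Gamma> w \<otimes>\<^bsub>?\<Gamma>\<^esub> x)) \<le> 2 * sqrt 2 * h x" if x: "x \<in> carrier ?\<Gamma>" for x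
    proof -
      let ?\<tau> = "\<lambda>j. inv\<^bsub>?\<Gamma>\<^esub> (act (\<kappa> j))"
      have "\<phi> (?\<tau> j \<circ> x) = \<phi> x" if "j < 3" for j
        using hom.hom_mult[OF lamp.inv_closed[OF \<kappa>_mem(1)[OF that]] x] \<kappa>_mem[OF that] \<phi>_closed[OF x] by simp
      \<comment> \<open>\<open>toggle j\<close> is an involution, so on the fibre over \<one> the
        inverse acts just as \<open>act (\<kappa> j)\<close> does; on other fibres the two may
        differ.\<close>
      moreover have "?\<tau> j (\<one>, u) = (\<one>, toggle j u)" if "j < 3" for j u
      proof -
        have "?\<tau> j (act (\<kappa> j) (\<one>, toggle j u)) = (\<one>, toggle j u)"
          using lamp.l_inv[OF \<kappa>_mem(1)[OF that]] by (metis comp_apply id_apply perm_group_simps)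
        then show ?thesis by (simp add: \<kappa>(3)[OF that])
      qed
      ultimately have "(\<Sum>j<3. h (?\<tau> j \<circ> x)) \<le> 2 * sqrt 2 * h x" by (intro super[OF x]) auto
      then show ?thesis unfolding sumQ[of "\<lambda>\<gamma>. h (inv\<^bsub>?\<Gamma>\<^esub> \<gamma> \<otimes>\<^bsub>?\<Gamma>\<^esub> x)"] by simp
    qed
  qed simp
  have "lamp.growth ^ L \<le> growth ^ L - K.excess"
  proof (rule K.growth_power_le[OF growth_nonneg])
    fix n
    have "card {w. set w \<subseteq> letters \<and> length w = n \<and> word_val G (map \<phi> w) = \<one>}
        = card {w. set w \<subseteq> S \<and> length w = n \<and> word_val G (map \<phi> (map lamp w)) = \<one>}"
      by (rule card_identity_words_lamp)
    also have "{w. set w \<subseteq> S \<and> length w = n \<and> word_val G (map \<phi> (map lamp w)) = \<one>} = identity_words G S n"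
      using \<phi>_lamp by (auto simp: identity_words_def simp del: map_map)
    finally show "real (card {w. set w \<subseteq> letters \<and> length w = n \<and> word_val G (map \<phi> w) = \<one>}) \<le> growth ^ n"
      using identity_words_le_growth[of n] Tpos card_letters by simp
  qed
  moreover have "K.excess > 0"
  proof -
    have "(2 * sqrt 2)\<^sup>2 < (3::real)\<^sup>2" by simp
    then have "2 * sqrt 2 < (3::real)" by (rule power2_less_imp_less) simp
    then show ?thesis by (simp add: K.excess_def cardQ)
  qed
  ultimately have "lamp.growth ^ L < growth ^ L" by simp
  then show ?thesis using growth_nonneg by (rule power_less_imp_less_base)
qed

end

section \<open>Shortest loops, remote points, and approximation from below\<close>

context marked_group
begin

text \<open>A walk without backtracking. The one-letter word \<one> is reduced when \<one> belongs
  to \<open>S\<close>, so the Cayley graph is a tree exactly if no nonempty reduced word has value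
  \<one>.\<close>

definition reduced :: "'a list \<Rightarrow> bool" where
  "reduced w \<longleftrightarrow> set w \<subseteq> S \<and> successively (\<lambda>s t. s \<otimes> t \<noteq> \<one>) w"

text \<open>Take a nonempty reduced word of value \<one> of minimal length. If it crossed its first
  edge twice, either a proper subword would already be a loop or the second letter would cancel the
  first.\<close>

lemma shortest_loop:
  assumes "reduced w" "w \<noteq> []" "word_val G w = \<one>"
  shows "\<exists>w' s. s \<in> S \<and> set w' \<subseteq> S \<and> word_val G (w' @ [s]) = \<one> \<and>
    (\<forall>u t v. w' = u @ t # v \<longrightarrow> {word_val G (v @ [s]), t \<otimes> word_val G (v @ [s])} \<noteq> {\<one>, s})"
proof -
  define P where "P w \<longleftrightarrow> reduced w \<and> w \<noteq> [] \<and> word_val G w = \<one>" for w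
  obtain z where z: "P z" "\<And>y. P y \<Longrightarrow> length z \<le> length y"
    using ex_has_least_nat[of P w length] assms by (auto simp: P_def)
  obtain w' s where zs: "z = w' @ [s]" using z(1) by (cases z rule: rev_cases) (auto simp: P_def)
  have s: "s \<in> S" "set w' \<subseteq> S" "s \<in> carrier G" using z(1) sub by (auto simp: P_def reduced_def zs)
  have "{word_val G (v @ [s]), t \<otimes> word_val G (v @ [s])} \<noteq> {\<one>, s}" if w': "w' = u @ t # v" for u t v
  proof
    assume eq: "{word_val G (v @ [s]), t \<otimes> word_val G (v @ [s])} = {\<one>, s}"
    have vt: "set v \<subseteq> S" "t \<in> S" "t \<in> carrier G" using s sub by (auto simp: w')
    have sub_red: "reduced y" if "z = a @ y @ b" for a y b
      using z(1) unfolding P_def reduced_def that by (auto simp: successively_append_iff)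
    have nontriv: "word_val G y \<noteq> \<one>" if "z = a @ y @ b" "y \<noteq> []" "length y < length z" for a y b
      using z(2)[of y] sub_red[OF that(1)] that by (auto simp: P_def)
    have "word_val G (v @ [s]) \<noteq> \<one>" using nontriv[of "u @ [t]" "v @ [s]" "[]"] by (simp add: zs w')
    then have vs: "word_val G (v @ [s]) = s" using eq by auto
    have "word_val G v \<otimes> s = s" using vs vt s word_append[of v "[s]"] by simp
    then have "word_val G v = \<one>" using word_closed[OF vt(1)] s by (simp add: r_cancel_one)
    then have v: "v = []" using nontriv[of "u @ [t]" v "[s]"] by (auto simp: zs w')
    have "s \<noteq> \<one>" using nontriv[of "u @ [t]" "[s]" "[]"] s by (auto simp: zs w' v)
    then have "t \<otimes> s = \<one>" using eq vs by (auto simp: doubleton_eq_iff)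
    moreover have "reduced ([t] @ [s])" using sub_red[of u "[t, s]" "[]"] by (simp add: zs w' v)
    ultimately show False by (simp add: reduced_def)
  qed
  then show ?thesis using s z(1) by (auto simp: P_def zs intro!: exI[of _ w'] exI[of _ s])
qed

lemma remote_points:
  assumes "infinite (carrier G)"
  shows "\<exists>g. (\<forall>i<3. g i \<in> carrier G) \<and> (\<forall>i j w. i < 3 \<longrightarrow> j < (3::nat) \<longrightarrow> i \<noteq> j \<longrightarrow>
    set w \<subseteq> S \<longrightarrow> length w \<le> D \<longrightarrow> word_val G w \<otimes> g i \<noteq> g j)"
proof -
  define B where "B = word_val G ` {w. set w \<subseteq> S \<and> length w \<le> D}"
  \<comment> \<open>Closed under inverses, so that each new point need only avoid the translates of
    \<open>C\<close> by the earlier points.\<close>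
  define C where "C = B \<union> m_inv G ` B"
  have B: "B \<subseteq> carrier G" using word_closed by (auto simp: B_def)
  have finC: "finite C" unfolding C_def B_def using finite_lists_length_le[OF fin, of D] by simp
  have "infinite (carrier G - C)" using assms finC by simp
  then have "carrier G - C \<noteq> {}" by (rule infinite_imp_nonempty)
  then obtain a where a: "a \<in> carrier G" "a \<notin> C" by blast
  have "infinite (carrier G - (C \<union> (\<lambda>x. x \<otimes> a) ` C))" using assms finC by simp
  then have "carrier G - (C \<union> (\<lambda>x. x \<otimes> a) ` C) \<noteq> {}" by (rule infinite_imp_nonempty)
  then obtain b where b: "b \<in> carrier G" "b \<notin> C" "b \<notin> (\<lambda>x. x \<otimes> a) ` C" by blast
  define g where "g i = (if i = 0 then \<one> else if i = 1 then a else b)" for i :: nat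
  have "word_val G w \<otimes> g i \<noteq> g j"
    if "i < 3" "j < 3" "i \<noteq> j" "set w \<subseteq> S" "length w \<le> D" for i j w
  proof
    assume eq: "word_val G w \<otimes> g i = g j"
    define x where "x = word_val G w"
    have x: "x \<in> carrier G" "x \<in> C" "inv x \<in> C"
      using that word_closed by (auto simp: x_def C_def B_def)
    have gc: "g l \<in> carrier G" for l using a b by (simp add: g_def)
    have eq': "g i = inv x \<otimes> g j"
      using eq x(1) gc by (simp add: x_def[symmetric] inv_solve_left)
    have *: "g m \<noteq> y \<otimes> g l" if "l < m" "m < 3" "y \<in> C" "y \<in> carrier G" for l m y
      using that a b by (auto simp: g_def)
    show False
    proof (cases "i < j")
      case True
      then show False using *[of i j x] eq x that by (simp add: x_def)
    next
      case False
      then show False using *[of j i "inv x"] eq' x that by simp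
    qed
  qed
  moreover have "g i \<in> carrier G" for i using a b by (simp add: g_def)
  ultimately show ?thesis by blast
qed

lemma growth_pos:
  assumes "s \<in> S"
  shows "growth > 0"
proof -
  have "[s, inv s] \<in> identity_words G S 2"
    using assms inv_S sub by (auto simp: identity_words_def)
  then have "card (identity_words G S 2) > 0"
    using finite_identity_words[OF fin] by (auto simp: card_gt_0_iff)
  moreover have "card S > 0" using assms fin by (auto simp: card_gt_0_iff)
  ultimately have "growth ^ 2 > 0" using identity_words_le_growth[of 2] by linarith
  then show ?thesis using growth_nonneg by (cases "growth = 0") auto
qed

theorem exists_spectral_radius_slightly_below:
  assumes "infinite (carrier G)" and w: "reduced w" "w \<noteq> []" "word_val G w = \<one>" and "\<epsilon> > 0"
  shows "\<exists>y\<in>X_rho (card S). spectral_radius G S - \<epsilon> < y \<and> y < spectral_radius G S"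
proof -
  obtain w' s where s: "s \<in> S" "set w' \<subseteq> S" "word_val G (w' @ [s]) = \<one>"
    and simple: "\<And>u t v. w' = u @ t # v \<Longrightarrow> {word_val G (v @ [s]), t \<otimes> word_val G (v @ [s])} \<noteq> {\<one>, s}"
    using shortest_loop[OF w] by blast
  have k: "card S > 0" using s fin by (auto simp: card_gt_0_iff)
  \<comment> \<open>The target rate, cut off at 0 since \<open>growth_le_iff\<close> asks for a
    nonnegative rate. It fails at a single \<open>n\<close>, and only the closed words of this
    length have to be controlled in the cover.\<close>
  define r0 where "r0 = max 0 (growth - card S * \<epsilon>)"
  have r0: "r0 < growth" "0 \<le> r0" using growth_pos[OF s(1)] k \<open>\<epsilon> > 0\<close> by (auto simp: r0_def)
  then obtain n where n: "real (card (identity_words G S n)) > r0 ^ n"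
    using growth_le_iff[of r0] k by (meson not_le)
  \<comment> \<open>At least \<open>n\<close> for the pigeonhole argument, and at least the length
    of the loop so that the loop sees only its own lamp.\<close>
  define r where "r = max n (Suc (length w'))"
  obtain g where g: "\<And>i. i < 3 \<Longrightarrow> g i \<in> carrier G"
    "\<And>i j w. i < 3 \<Longrightarrow> j < (3::nat) \<Longrightarrow> i \<noteq> j \<Longrightarrow> set w \<subseteq> S \<Longrightarrow> length w \<le> 2 * r \<Longrightarrow>
      word_val G w \<otimes> g i \<noteq> g j"
    using remote_points[OF assms(1), of "2 * r"] by blast
  interpret L: remote_lamps G S g s r w'
    by unfold_locales (use s g simple in \<open>auto simp: r_def\<close>)
  let ?y = "spectral_radius L.lamp_group L.letters"
  have y: "L.lamp.growth = card S * ?y" using L.card_letters by (simp add: L.lamp.growth_def)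
  have "r0 ^ n < L.lamp.growth ^ n"
    using n L.identity_words_le_lamp_growth[of n] by (simp add: r_def)
  then have "r0 < L.lamp.growth"
    using L.lamp.growth_nonneg by (rule power_less_imp_less_base)
  then have "card S * (spectral_radius G S - \<epsilon>) < card S * ?y"
    by (simp add: r0_def y growth_def algebra_simps)
  moreover have "card S * ?y < card S * spectral_radius G S"
    using L.lamp_growth_less by (simp add: y growth_def)
  moreover have "?y \<in> X_rho (card S)"
    using L.lamp.spectral_radius_mem L.card_letters by simp
  ultimately show ?thesis using k by (intro bexI[of _ ?y]) auto
qed

end

section \<open>Counting words that cancel to the empty word\<close>

text \<open>The number of words of length \<open>n\<close> over \<open>k\<close> letters whose free reduction has length \<open>j\<close>.\<close>

fun cancel_count :: "nat \<Rightarrow> nat \<Rightarrow> nat \<Rightarrow> nat" where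
  "cancel_count k 0 j = (if j = 0 then 1 else 0)"
| "cancel_count k (Suc n) 0 = cancel_count k n 1"
| "cancel_count k (Suc n) (Suc j) =
     cancel_count k n (Suc (Suc j)) + (if j = 0 then k else k - 1) * cancel_count k n j"

section \<open>Free reduction as a stack process\<close>

context marked_group
begin

definition push :: "'a \<Rightarrow> 'a list \<Rightarrow> 'a list" where
  "push s u = (if u \<noteq> [] \<and> s \<otimes> hd u = \<one> then tl u else s # u)"

definition reduction :: "'a list \<Rightarrow> 'a list" where "reduction w = foldr push w []"

lemma reduction_Nil [simp]: "reduction [] = []" and reduction_Cons: "reduction (s # w) = push s (reduction w)"
  by (simp_all add: reduction_def)

lemma reduced_reduction: "set w \<subseteq> S \<Longrightarrow> reduced (reduction w)"
proof (induction w)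
  case (Cons s w)
  then show ?case
    by (cases "reduction w") (auto simp: reduction_Cons push_def reduced_def successively_Cons)
qed (simp add: reduced_def)

lemma word_val_reduction: "set w \<subseteq> S \<Longrightarrow> word_val G (reduction w) = word_val G w"
proof (induction w)
  case (Cons s w)
  have r: "reduced (reduction w)" using Cons.prems by (intro reduced_reduction) auto
  show ?case
  proof (cases "reduction w \<noteq> [] \<and> s \<otimes> hd (reduction w) = \<one>")
    case True
    then obtain t u where tu: "reduction w = t # u" by (cases "reduction w") auto
    have "t \<in> carrier G" "set u \<subseteq> S" "s \<in> carrier G" using r tu Cons.prems sub by (auto simp: reduced_def)
    moreover have "word_val G w = t \<otimes> word_val G u" using Cons tu by simp
    moreover have "s \<otimes> t = \<one>" using True tu by simp
    ultimately have "word_val G (s # w) = word_val G u"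
      using word_closed[of u] by (simp add: m_assoc[symmetric])
    then show ?thesis using True tu by (simp add: reduction_Cons push_def)
  next
    case False
    then have "reduction (s # w) = s # reduction w" unfolding reduction_Cons push_def by (rule if_not_P)
    then show ?thesis using Cons by simp
  qed
qed simp

text \<open>Exactly one letter, the inverse of the head, shortens a nonempty reduction, and the
  other k - 1 lengthen it; all k letters lengthen the empty one. Hence the distribution depends on k
  alone.\<close>

lemma card_reduction_length:
  "card {w. set w \<subseteq> S \<and> length w = n \<and> length (reduction w) = j} = cancel_count (card S) n j"
proof (induction n arbitrary: j)
  case 0
  have "{w. set w \<subseteq> S \<and> length w = 0 \<and> length (reduction w) = j} = (if j = 0 then {[]} else {})"
    by auto
  then show ?case by simp
next
  case (Suc n)
  let ?W = "\<lambda>n j. {w. set w \<subseteq> S \<and> length w = n \<and> length (reduction w) = j}"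
  have finW: "finite (?W n j)" for n j
    by (rule finite_subset[OF _ finite_lists_length_eq[OF fin, of n]]) auto
  define pop where "pop w = inv (hd (reduction w))" for w
  have hd_S: "hd (reduction w) \<in> S" if "w \<in> ?W n (Suc i)" for w i
    using that reduced_reduction[of w] by (cases "reduction w") (auto simp: reduced_def)
  have pop_iff: "s = pop w \<longleftrightarrow> s \<otimes> hd (reduction w) = \<one>" if "w \<in> ?W n (Suc i)" "s \<in> S" for s w i
    using hd_S[OF that(1)] that(2) sub unfolding pop_def
    by (metis inv_equality l_inv subsetD)
  have pop_S: "pop w \<in> S" if "w \<in> ?W n (Suc i)" for w i
    unfolding pop_def using hd_S[OF that] by (rule inv_S)
  define down where "down i = (\<lambda>w. pop w # w) ` ?W n (Suc i)" for i
  define up where "up i = (\<lambda>(w, s). s # w) ` (SIGMA w:?W n i. if i = 0 then S else S - {pop w})" for i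
  have card_down: "card (down i) = cancel_count (card S) n (Suc i)" for i
    unfolding down_def by (subst card_image) (auto simp: inj_on_def Suc)
  have card_up: "card (up i) = (if i = 0 then card S else card S - 1) * cancel_count (card S) n i" for i
  proof -
    have "card (up i) = card (SIGMA w:?W n i. if i = 0 then S else S - {pop w})"
      unfolding up_def by (rule card_image) (auto simp: inj_on_def)
    also have "\<dots> = (\<Sum>w\<in>?W n i. card (if i = 0 then S else S - {pop w}))"
      using finW fin by (intro card_SigmaI) auto
    also have "\<dots> = (\<Sum>w\<in>?W n i. if i = 0 then card S else card S - 1)"
    proof (rule sum.cong[OF refl])
      fix w assume "w \<in> ?W n i"
      then show "card (if i = 0 then S else S - {pop w}) = (if i = 0 then card S else card S - 1)"
        using pop_S[of w "i - 1"] fin by (cases i) (auto simp: card_Diff_singleton)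
    qed
    finally show ?thesis by (simp add: Suc)
  qed
  have len_push: "length (push s u) = (if u \<noteq> [] \<and> s \<otimes> hd u = \<one> then length u - 1 else Suc (length u))" for s u
    by (simp add: push_def)
  have split: "?W (Suc n) i = down i \<union> (if i = 0 then {} else up (i - 1))" for i
  proof (intro equalityI subsetI)
    fix x assume x: "x \<in> ?W (Suc n) i"
    then obtain s w where sw: "x = s # w" "s \<in> S" "set w \<subseteq> S" "length w = n" by (cases x) auto
    show "x \<in> down i \<union> (if i = 0 then {} else up (i - 1))"
    proof (cases "reduction w \<noteq> [] \<and> s \<otimes> hd (reduction w) = \<one>")
      case True
      then have w: "w \<in> ?W n (Suc i)" using x sw len_push[of s "reduction w"] by (auto simp: reduction_Cons)
      then have "s = pop w" using pop_iff[OF w sw(2)] True by simp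
      then show ?thesis using w sw unfolding down_def by blast
    next
      case False
      then have i: "i = Suc (length (reduction w))"
        using x sw len_push[of s "reduction w"] by (simp add: reduction_Cons split: if_splits)
      then have w: "w \<in> ?W n (i - 1)" using sw by simp
      have "s \<in> (if i - 1 = 0 then S else S - {pop w})"
      proof (cases "i - 1")
        case (Suc i')
        then have "w \<in> ?W n (Suc i')" using w by simp
        moreover have "reduction w \<noteq> []" using w Suc by auto
        ultimately have "s \<noteq> pop w" using pop_iff[of w i' s] False sw(2) by blast
        then show ?thesis using sw(2) Suc by simp
      qed (use sw in simp)
      then have "x \<in> up (i - 1)" unfolding up_def sw(1) using w by (intro image_eqI[of _ _ "(w, s)"]) auto
      then show ?thesis using i by simp
    qed
  next
    fix x assume "x \<in> down i \<union> (if i = 0 then {} else up (i - 1))"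
    then consider "x \<in> down i" | i' where "i = Suc i'" "x \<in> up i'" by (cases i) auto
    then show "x \<in> ?W (Suc n) i"
    proof cases
      case 1
      then obtain w where w: "w \<in> ?W n (Suc i)" "x = pop w # w" unfolding down_def by blast
      have "pop w \<otimes> hd (reduction w) = \<one>" using pop_iff[OF w(1) pop_S[OF w(1)]] by simp
      moreover have "reduction w \<noteq> []" using w by auto
      ultimately show ?thesis
        using w pop_S[OF w(1)] len_push[of "pop w" "reduction w"] by (simp add: reduction_Cons)
    next
      case 2
      then obtain w s where w: "w \<in> ?W n i'" "s \<in> (if i' = 0 then S else S - {pop w})" "x = s # w"
        unfolding up_def by auto
      then have s: "s \<in> S" by (auto split: if_splits)
      have "\<not> (reduction w \<noteq> [] \<and> s \<otimes> hd (reduction w) = \<one>)"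
      proof (cases i')
        case 0
        then show ?thesis using w by simp
      next
        case (Suc l)
        then have "w \<in> ?W n (Suc l)" "s \<noteq> pop w" using w by auto
        then show ?thesis using pop_iff[of w l s] s by blast
      qed
      then have "length (reduction (s # w)) = Suc (length (reduction w))"
        unfolding reduction_Cons len_push by (rule if_not_P)
      then show ?thesis using w s 2 by simp
    qed
  qed
  show ?case
  proof (cases j)
    case 0
    then show ?thesis using split[of 0] card_down[of 0] by simp
  next
    case (Suc i)
    have "down (Suc i) \<inter> up i = {}"
    proof (rule ccontr)
      assume "down (Suc i) \<inter> up i \<noteq> {}"
      then obtain w w' s where "w \<in> ?W n (Suc (Suc i))" "w' \<in> ?W n i" "pop w # w = s # w'"
        unfolding down_def up_def by auto
      then show False by auto
    qed
    moreover have "finite (down (Suc i))" "finite (up i)"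
      unfolding down_def up_def using finW fin by (auto intro!: finite_imageI finite_SigmaI)
    ultimately have "card (?W (Suc n) (Suc i)) = card (down (Suc i)) + card (up i)"
      unfolding split by (simp add: card_Un_disjoint)
    then show ?thesis using Suc card_down card_up by simp
  qed
qed

text \<open>Words that cancel freely are trivial in every group. Together with
  \<open>cancel_count_eq\<close> this makes the growth of a tree minimal among all groups with the
  same number of letters.\<close>

lemma cancel_count_le: "cancel_count (card S) n 0 \<le> card (identity_words G S n)"
proof -
  have "word_val G w = \<one>" if "set w \<subseteq> S" "reduction w = []" for w
    using word_val_reduction[OF that(1)] that(2) by simp
  then show ?thesis unfolding card_reduction_length[symmetric]
    by (intro card_mono finite_identity_words fin) (auto simp: identity_words_def)
qed

lemma cancel_count_eq:
  assumes "\<And>w. reduced w \<Longrightarrow> word_val G w = \<one> \<Longrightarrow> w = []"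
  shows "card (identity_words G S n) = cancel_count (card S) n 0"
proof -
  have "reduction w = [] \<longleftrightarrow> word_val G w = \<one>" if "set w \<subseteq> S" for w
    using word_val_reduction[OF that] assms[OF reduced_reduction[OF that]] by auto
  then have "identity_words G S n = {w. set w \<subseteq> S \<and> length w = n \<and> length (reduction w) = 0}"
    by (auto simp: identity_words_def)
  then show ?thesis by (simp only: card_reduction_length)
qed

end

section \<open>The integers\<close>

definition int_group :: "int monoid" where
  "int_group = \<lparr>carrier = UNIV, mult = (+), one = 0\<rparr>"

text \<open>A symmetric set of integers has odd size exactly if it contains 0, which fixes the
  treatment of 0.\<close>

definition int_gens :: "nat \<Rightarrow> int set" where
  "int_gens k = (if odd k then {- int (k div 2)..int (k div 2)} else {- int (k div 2)..int (k div 2)} - {0})"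

lemma int_group_simps [simp]:
  "carrier int_group = UNIV" "mult int_group = (+)" "one int_group = 0"
  by (simp_all add: int_group_def)

lemma group_int_group: "group int_group"
  by (rule groupI) (auto intro: exI[of _ "- x" for x])

lemma inv_int_group [simp]: "inv\<^bsub>int_group\<^esub> x = - x"
  using group.inv_equality[OF group_int_group, of "- x" x] by simp

lemma card_int_gens: "card (int_gens k) = k"
proof (cases "odd k")
  case True
  then obtain h where "k = 2 * h + 1" by (rule oddE)
  then show ?thesis by (simp add: int_gens_def nat_add_distrib nat_mult_distrib)
next
  case False
  then obtain h where "k = 2 * h" by (auto elim: evenE)
  then show ?thesis by (simp add: int_gens_def card_Diff_singleton nat_add_distrib nat_mult_distrib)
qed

lemma marked_int_group:
  assumes "k \<ge> 2"
  shows "marked_group int_group (int_gens k)"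
proof -
  interpret group int_group by (rule group_int_group)
  let ?S = "int_gens k"
  have "m_inv int_group ` ?S = ?S"
  proof
    show "?S \<subseteq> m_inv int_group ` ?S"
    proof
      fix x assume "x \<in> ?S"
      then show "x \<in> m_inv int_group ` ?S"
        by (intro image_eqI[of _ _ "- x"]) (auto simp: int_gens_def split: if_splits)
    qed
  qed (auto simp: int_gens_def split: if_splits)
  moreover have "x \<in> generate int_group ?S" for x
  proof -
    have one: "1 \<in> generate int_group ?S"
      using assms by (intro generate.incl) (auto simp: int_gens_def)
    have nat: "int n \<in> generate int_group ?S" for n
    proof (induction n)
      case 0
      show ?case using generate.one[of int_group ?S] by simp
    next
      case (Suc n)
      show ?case using generate.eng[OF one Suc] by simp
    qed
    show ?thesis
    proof (cases "x \<ge> 0")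
      case True
      then show ?thesis using nat[of "nat x"] by simp
    next
      case False
      then show ?thesis
        using generate_m_inv_closed[of ?S "- x"] nat[of "nat (- x)"] by simp
    qed
  qed
  moreover have "finite ?S" by (simp add: int_gens_def)
  ultimately show ?thesis
    using is_group by (auto simp: marked_group_def marked_group_axioms_def symmetric_generating_set_def)
qed

lemma exists_spectral_radius_below_1:
  assumes "k \<ge> 3" "\<epsilon> > 0"
  shows "\<exists>y\<in>X_rho k. 1 - \<epsilon> < y \<and> y < 1"
proof -
  let ?S = "int_gens k" and ?h = "k div 2"
  interpret Z: marked_group int_group ?S using assms by (intro marked_int_group) simp
  have "spectral_radius int_group ?S = 1"
  proof (rule Z.spectral_radius_eq_1)
    show "card ?S > 0" using assms by (simp add: card_int_gens)
    fix n
    have "word_val int_group w \<in> {- int (?h * length w)..int (?h * length w)}" if "set w \<subseteq> ?S" for w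
      using that
    proof (induction w)
      case (Cons s w)
      have "- int ?h \<le> s" "s \<le> int ?h" using Cons.prems by (auto simp: int_gens_def split: if_splits)
      with Cons show ?case by (auto simp: algebra_simps)
    qed simp
    then have "word_val int_group ` {w. set w \<subseteq> ?S \<and> length w = n} \<subseteq> {- int (?h * n)..int (?h * n)}"
      by blast
    then have "card (word_val int_group ` {w. set w \<subseteq> ?S \<and> length w = n}) \<le> card {- int (?h * n)..int (?h * n)}"
      by (intro card_mono) auto
    also have "\<dots> = 2 * ?h * n + 1"
      by (simp add: nat_add_distrib nat_mult_distrib mult_ac flip: of_nat_mult)
    finally show "real (card (word_val int_group ` {w. set w \<subseteq> ?S \<and> length w = n})) \<le> real (2 * ?h) * real n + 1"
      by (simp flip: of_nat_mult of_nat_Suc)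
  qed
  moreover have "\<exists>w. Z.reduced w \<and> w \<noteq> [] \<and> word_val int_group w = \<one>\<^bsub>int_group\<^esub>"
  proof (cases "odd k")
    case True
    then have "Z.reduced [0]" unfolding Z.reduced_def by (simp add: int_gens_def)
    then show ?thesis by (intro exI[of _ "[0]"]) simp
  next
    case False
    then have "k \<ge> 4" using assms by presburger
    then have "Z.reduced [1, 1, - 2]"
      unfolding Z.reduced_def using False by (auto simp: int_gens_def)
    then show ?thesis by (intro exI[of _ "[1, 1, - 2]"]) simp
  qed
  moreover have "infinite (carrier int_group)" by (simp add: infinite_UNIV_int)
  ultimately show ?thesis
    using Z.exists_spectral_radius_slightly_below assms(2) by (metis card_int_gens)
qed

section \<open>Trees of long cycles\<close>

text \<open>The weight \<open>h\<close> summed over the endpoints of all words of length n is at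
  most \<open>\<mu> ^ n * h x0\<close>, and each identity word returns to \<open>x0\<close> and
  contributes \<open>h x0\<close>.\<close>

lemma (in marked_group) growth_le_supersolution:
  fixes h :: "'y \<Rightarrow> real" and \<alpha> :: "'a \<Rightarrow> 'y \<Rightarrow> 'y"
  assumes "x0 \<in> V" "0 \<le> \<mu>" "card S > 0"
    and V: "\<And>s x. s \<in> S \<Longrightarrow> x \<in> V \<Longrightarrow> \<alpha> s x \<in> V"
    and h: "\<And>x. x \<in> V \<Longrightarrow> h x > 0" "\<And>x. x \<in> V \<Longrightarrow> (\<Sum>s\<in>S. h (\<alpha> s x)) \<le> \<mu> * h x"
    and action: "\<And>w. set w \<subseteq> S \<Longrightarrow> word_val G w = \<one> \<Longrightarrow> foldr \<alpha> w x0 = x0"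
  shows "growth \<le> \<mu>"
proof (subst growth_le_iff[OF assms(2,3)], rule allI)
  fix n
  let ?W = "\<lambda>n. {w. set w \<subseteq> S \<and> length w = n}"
  have finW: "finite (?W n)" for n by (rule finite_lists_length_eq[OF fin])
  have inV: "foldr \<alpha> w x0 \<in> V" if "set w \<subseteq> S" for w
    using that by (induction w) (auto simp: assms(1) V)
  have total: "(\<Sum>w\<in>?W n. h (foldr \<alpha> w x0)) \<le> \<mu> ^ n * h x0" for n
  proof (induction n)
    case 0
    have "?W 0 = {[]}" by auto
    then show ?case by simp
  next
    case (Suc n)
    have "?W (Suc n) = (\<lambda>(w, s). s # w) ` (?W n \<times> S)"
    proof (intro equalityI subsetI)
      fix w assume "w \<in> ?W (Suc n)"
      then show "w \<in> (\<lambda>(w, s). s # w) ` (?W n \<times> S)" by (cases w) auto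
    qed auto
    moreover have "inj_on (\<lambda>(w, s). s # w) (?W n \<times> S)" by (auto simp: inj_on_def)
    ultimately have "(\<Sum>w\<in>?W (Suc n). h (foldr \<alpha> w x0))
        = (\<Sum>(w, s)\<in>?W n \<times> S. h (\<alpha> s (foldr \<alpha> w x0)))"
      by (simp only: sum.reindex) (simp add: case_prod_beta)
    also have "\<dots> = (\<Sum>w\<in>?W n. \<Sum>s\<in>S. h (\<alpha> s (foldr \<alpha> w x0)))"
      by (rule sum.cartesian_product[symmetric])
    also have "\<dots> \<le> (\<Sum>w\<in>?W n. \<mu> * h (foldr \<alpha> w x0))"
      using inV by (intro sum_mono h(2)) auto
    also have "\<dots> \<le> \<mu> ^ Suc n * h x0"
      using Suc assms(2) by (simp flip: sum_distrib_left add: mult.assoc mult_left_mono)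
    finally show ?case .
  qed
  have "real (card (identity_words G S n)) * h x0 = (\<Sum>w\<in>identity_words G S n. h (foldr \<alpha> w x0))"
    using action by (simp add: identity_words_def)
  also have "\<dots> \<le> (\<Sum>w\<in>?W n. h (foldr \<alpha> w x0))"
    using finW inV h(1) by (intro sum_mono2) (auto simp: identity_words_def less_imp_le)
  also have "\<dots> \<le> \<mu> ^ n * h x0" by (rule total)
  finally show "real (card (identity_words G S n)) \<le> \<mu> ^ n" using h(1)[OF assms(1)] by simp
qed

text \<open>The Cayley graph of the free product of a cyclic group of order \<open>m\<close> and \<open>k - 2\<close> groups of
  order two. The vertex \<open>(p, H)\<close> has position \<open>p\<close> on its \<open>m\<close>-cycle, and an entry \<open>(j, p')\<close> of \<open>H\<close>
  records an edge of type \<open>j\<close> leading from position \<open>p'\<close> of the preceding cycle to position 0 of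
  the next one. All moves fix the inadmissible pairs, so that they are permutations of the whole
  type.\<close>

locale cycle_tree =
  fixes k m :: nat
  assumes k: "k \<ge> 3" and m: "m \<ge> 3"
begin

text \<open>The last clause: at position 0 the edge of the most recent type leads back to the
  preceding cycle, so it cannot open a new one.\<close>

fun admissible :: "(nat \<times> nat) list \<Rightarrow> bool" where
  "admissible [] = True"
| "admissible ((j, p) # H) \<longleftrightarrow> j < k - 2 \<and> p < m \<and> admissible H \<and> (p = 0 \<longrightarrow> H = [] \<or> fst (hd H) \<noteq> j)"

definition vertices :: "(nat \<times> (nat \<times> nat) list) set" where
  "vertices = {(p, H). p < m \<and> admissible H}"

definition rot :: "nat \<times> (nat \<times> nat) list \<Rightarrow> nat \<times> (nat \<times> nat) list" where
  "rot x = (if x \<in> vertices then (if Suc (fst x) = m then 0 else Suc (fst x), snd x) else x)"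

definition rot_inv :: "nat \<times> (nat \<times> nat) list \<Rightarrow> nat \<times> (nat \<times> nat) list" where
  "rot_inv x = (if x \<in> vertices then (if fst x = 0 then m - 1 else fst x - 1, snd x) else x)"

definition flip :: "nat \<Rightarrow> nat \<times> (nat \<times> nat) list \<Rightarrow> nat \<times> (nat \<times> nat) list" where
  "flip j x = (if x \<in> vertices then
     (if fst x = 0 \<and> snd x \<noteq> [] \<and> fst (hd (snd x)) = j then (snd (hd (snd x)), tl (snd x))
      else (0, (j, fst x) # snd x)) else x)"

definition moves :: "(nat \<times> (nat \<times> nat) list \<Rightarrow> nat \<times> (nat \<times> nat) list) set" where
  "moves = insert rot (insert rot_inv (flip ` {..<k - 2}))"

abbreviation root :: "nat \<times> (nat \<times> nat) list" where "root \<equiv> (0, [])"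

lemma root: "root \<in> vertices" using m by (simp add: vertices_def)

lemma rot_vertices: "x \<in> vertices \<Longrightarrow> rot x \<in> vertices"
  and rot_inv_vertices: "x \<in> vertices \<Longrightarrow> rot_inv x \<in> vertices"
  using m by (auto simp: rot_def rot_inv_def vertices_def)

lemma flip_vertices:
  assumes "j < k - 2" "x \<in> vertices"
  shows "flip j x \<in> vertices"
proof -
  obtain p H where x: "x = (p, H)" by (cases x)
  show ?thesis using assms m unfolding x by (cases H) (auto simp: flip_def vertices_def)
qed

lemma rot_inv_rot: "rot_inv \<circ> rot = id" and rot_rot_inv: "rot \<circ> rot_inv = id"
  using m by (auto simp: fun_eq_iff rot_def rot_inv_def vertices_def)

lemma flip_flip:
  assumes "j < k - 2"
  shows "flip j \<circ> flip j = id"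
proof
  fix x :: "nat \<times> (nat \<times> nat) list"
  obtain p H where x: "x = (p, H)" by (cases x)
  show "(flip j \<circ> flip j) x = id x"
    using flip_vertices[OF assms, of x] unfolding x
    by (cases H) (auto simp: flip_def vertices_def)
qed

lemma rot_root: "rot root = (1, [])" and rot_inv_root: "rot_inv root = (m - 1, [])"
  and flip_root: "flip j root = (0, [(j, 0)])"
  using root m by (auto simp: rot_def rot_inv_def flip_def)

lemma distinct_moves: "rot \<noteq> rot_inv" "rot \<notin> range flip" "rot_inv \<notin> range flip" "inj flip"
proof -
  show "rot \<noteq> rot_inv"
  proof
    assume "rot = rot_inv"
    with rot_root rot_inv_root have "(1, []) = (m - 1, [] :: (nat \<times> nat) list)" by simp
    then show False using m by simp
  qed
  show "rot \<notin> range flip" using rot_root flip_root by (metis imageE list.distinct(1) prod.inject)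
  show "rot_inv \<notin> range flip" using rot_inv_root flip_root by (metis imageE list.distinct(1) prod.inject)
  show "inj flip" using flip_root by (intro injI) (metis list.inject prod.inject)
qed

lemma card_moves: "card moves = k"
proof -
  have "card (flip ` {..<k - 2}) = k - 2"
    using card_image[OF inj_on_subset[OF distinct_moves(4) subset_UNIV], of "{..<k - 2}"] by simp
  moreover have "rot_inv \<notin> flip ` {..<k - 2}" "rot \<notin> insert rot_inv (flip ` {..<k - 2})"
    using distinct_moves(1-3) by blast+
  ultimately show ?thesis using k by (simp add: moves_def)
qed

lemma sum_moves: "(\<Sum>t\<in>moves. F t) = F rot + F rot_inv + (\<Sum>j<k - 2. F (flip j))" for F :: "_ \<Rightarrow> real"
proof -
  have "(\<Sum>t\<in>flip ` {..<k - 2}. F t) = (\<Sum>j<k - 2. F (flip j))"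
    by (subst sum.reindex[OF inj_on_subset[OF distinct_moves(4) subset_UNIV]]) simp
  moreover have "rot_inv \<notin> flip ` {..<k - 2}" "rot \<notin> insert rot_inv (flip ` {..<k - 2})"
    using distinct_moves(1-3) by blast+
  ultimately show ?thesis by (simp add: moves_def)
qed

sublocale T: marked_group "perm_group moves" moves
proof (rule marked_perm_group)
  fix t assume "t \<in> moves"
  then consider "t = rot" | "t = rot_inv" | j where "t = flip j" "j < k - 2" by (auto simp: moves_def)
  then show "\<exists>t'\<in>moves. t' \<circ> t = id"
  proof cases
    case 1
    then show ?thesis using rot_inv_rot by (intro bexI[of _ rot_inv]) (auto simp: moves_def)
  next
    case 2
    then show ?thesis using rot_rot_inv by (intro bexI[of _ rot]) (auto simp: moves_def)
  next
    case 3
    then show ?thesis using flip_flip by (intro bexI[of _ "flip j"]) (auto simp: moves_def)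
  qed
qed (simp add: moves_def)

lemma infinite_carrier: "infinite (carrier (perm_group moves))"
proof -
  define f where "f n = word_val (perm_group moves) (concat (replicate n [flip 0, rot]))" for n
  have k2: "0 < k - 2" using k by simp
  have "f n root = (0, replicate n (0, 1))" for n
  proof (induction n)
    case (Suc n)
    have "admissible (replicate n (0, 1))" using m k by (induction n) auto
    then have "(0, replicate n (0, 1)) \<in> vertices" "(1, replicate n (0, 1)) \<in> vertices"
      using m by (auto simp: vertices_def)
    then have "flip 0 (rot (0, replicate n (0, 1))) = (0, replicate (Suc n) (0, 1))"
      using m by (simp add: rot_def flip_def)
    then show ?case using Suc by (simp add: f_def)
  qed (simp add: f_def)
  then have "inj f" by (intro injI) (metis length_replicate prod.inject)
  then have "infinite (range f)" by (rule range_inj_infinite)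
  moreover have "range f \<subseteq> carrier (perm_group moves)"
  proof -
    have "set (concat (replicate n [flip 0, rot])) \<subseteq> moves" for n
      using k2 by (induction n) (auto simp: moves_def)
    then show ?thesis unfolding f_def using T.word_closed by blast
  qed
  ultimately show ?thesis using finite_subset by blast
qed

lemma rot_funpow: "p + n < m \<Longrightarrow> (p, H) \<in> vertices \<Longrightarrow> (rot ^^ n) (p, H) = (p + n, H)"
  by (induction n) (auto simp: rot_def vertices_def)

lemma rot_funpow_m: "(rot ^^ m) x = x"
proof -
  obtain p H where x: "x = (p, H)" by (cases x)
  show ?thesis
  proof (cases "x \<in> vertices")
    case False
    then have "(rot ^^ n) x = x" for n by (induction n) (auto simp: rot_def)
    then show ?thesis .
  next
    case True
    then have p: "p < m" "admissible H" by (auto simp: x vertices_def)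
    have "(rot ^^ (m - 1 - p)) (p, H) = (m - 1, H)"
      using rot_funpow[of p "m - 1 - p" H] p by (simp add: vertices_def)
    then have "(rot ^^ Suc (m - 1 - p)) (p, H) = (0, H)"
      using p m by (simp add: rot_def vertices_def)
    then have "(rot ^^ (p + Suc (m - 1 - p))) (p, H) = (p, H)"
      unfolding funpow_add using rot_funpow[of 0 p H] p m by (simp add: vertices_def)
    then show ?thesis using p m by (simp add: x)
  qed
qed

text \<open>One full turn of a cycle; since \<open>m\<close> is at least 3, \<open>rot\<close> is
  not its own inverse and the word is reduced.\<close>

lemma reduced_loop:
  "\<exists>w. T.reduced w \<and> w \<noteq> [] \<and> word_val (perm_group moves) w = \<one>\<^bsub>perm_group moves\<^esub>"
proof -
  have "(rot \<circ> rot) root \<noteq> id root"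
    using rot_funpow[of 0 2 "[]"] root m by (simp add: numeral_2_eq_2)
  then have "rot \<circ> rot \<noteq> id" by metis
  then have "successively (\<lambda>s t. s \<otimes>\<^bsub>perm_group moves\<^esub> t \<noteq> \<one>\<^bsub>perm_group moves\<^esub>) (replicate n rot)" for n
    by (auto simp: successively_conv_nth)
  moreover have "word_val (perm_group moves) (replicate n rot) = rot ^^ n" for n
    by (induction n) auto
  then have "word_val (perm_group moves) (replicate m rot) = id"
    using rot_funpow_m by (auto simp: fun_eq_iff)
  moreover have "set (replicate m rot) \<subseteq> moves" by (auto simp: moves_def)
  ultimately have "T.reduced (replicate m rot) \<and> replicate m rot \<noteq> [] \<and>
      word_val (perm_group moves) (replicate m rot) = \<one>\<^bsub>perm_group moves\<^esub>"
    unfolding T.reduced_def perm_group_simps using m by simp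
  then show ?thesis by blast
qed

text \<open>The decay ratio of the k-regular tree: one parent and k - 1 children give 1 /
  \<open>\<theta>\<close> + (k - 1) \<open>\<theta>\<close> = 2 sqrt (k - 1).\<close>

definition \<theta> :: real where "\<theta> = 1 / sqrt (real k - 1)"

text \<open>A solution of \<open>f (p - 1) + f (p + 1) = (\<theta> + 1 / \<theta>) f p\<close> on the cycle, up to the defect at
  position 0.\<close>

definition cycle_weight :: "nat \<Rightarrow> real" where
  "cycle_weight p = (\<theta> ^ p + \<theta> ^ (m - p)) / (1 + \<theta> ^ m)"

text \<open>As \<open>cycle_weight 0\<close> = 1, moving onto a new cycle multiplies the weight by
  exactly \<open>\<theta>\<close>.\<close>

fun history_weight :: "(nat \<times> nat) list \<Rightarrow> real" where
  "history_weight [] = 1"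
| "history_weight ((j, p) # H) = \<theta> * cycle_weight p * history_weight H"

definition weight :: "nat \<times> (nat \<times> nat) list \<Rightarrow> real" where
  "weight x = cycle_weight (fst x) * history_weight (snd x)"

text \<open>The first term is k times \<open>alpha k\<close>. The second bounds the defect at
  position 0 and vanishes as \<open>m\<close> grows.\<close>

definition rate :: real where "rate = 2 * sqrt (real k - 1) + 2 * \<theta> ^ (m - 1)"

lemma \<theta>: "0 < \<theta>" "\<theta> < 1" "\<theta> * sqrt (real k - 1) = 1" "(real k - 1) * \<theta> = sqrt (real k - 1)"
proof -
  have "sqrt (real k - 1) > 1" using k by simp
  then show "0 < \<theta>" "\<theta> < 1" "\<theta> * sqrt (real k - 1) = 1" by (auto simp: \<theta>_def)
  have "real k - 1 = sqrt (real k - 1) * sqrt (real k - 1)" using k by simp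
  then show "(real k - 1) * \<theta> = sqrt (real k - 1)"
    by (simp add: \<theta>_def real_div_sqrt k)
qed

lemma cycle_weight_pos: "cycle_weight p > 0"
  unfolding cycle_weight_def using \<theta>(1) by (intro divide_pos_pos add_pos_pos) simp_all

lemma history_weight_pos: "history_weight H > 0"
  using \<theta> cycle_weight_pos by (induction H rule: history_weight.induct) auto

lemma cycle_weight_0: "cycle_weight 0 = 1" and cycle_weight_m: "cycle_weight m = 1"
  and cycle_weight_last: "cycle_weight (m - 1) = cycle_weight 1"
  and cycle_weight_1: "cycle_weight 1 \<le> \<theta> + \<theta> ^ (m - 1)"
proof -
  have pos: "1 + \<theta> ^ m > 0" using zero_less_power[OF \<theta>(1), of m] by linarith
  show "cycle_weight 0 = 1" "cycle_weight m = 1" using pos by (auto simp: cycle_weight_def)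
  show "cycle_weight (m - 1) = cycle_weight 1" using m by (simp add: cycle_weight_def)
  have "(\<theta> + \<theta> ^ (m - 1)) / (1 + \<theta> ^ m) \<le> (\<theta> + \<theta> ^ (m - 1)) / 1"
    using \<theta> pos by (intro divide_left_mono) auto
  then show "cycle_weight 1 \<le> \<theta> + \<theta> ^ (m - 1)" by (simp add: cycle_weight_def)
qed

lemma cycle_weight_rec:
  assumes "0 < p" "p < m"
  shows "cycle_weight (p - 1) + cycle_weight (Suc p) = (\<theta> + sqrt (real k - 1)) * cycle_weight p"
proof -
  let ?R = "sqrt (real k - 1)"
  obtain a where a: "p = Suc a" using assms by (cases p) auto
  obtain b where b: "m - p = Suc b" using assms by (cases "m - p") auto
  have mm: "m - (p - 1) = Suc (Suc b)" "m - Suc p = b" using a b by auto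
  have R: "?R * \<theta> = 1" using \<theta>(3) by (simp add: mult.commute)
  have R: "?R * (\<theta> * \<theta> ^ n) = \<theta> ^ n" for n unfolding mult.assoc[symmetric] R by simp
  have "\<theta> ^ a + \<theta> ^ Suc (Suc b) + (\<theta> ^ Suc (Suc a) + \<theta> ^ b)
      = (\<theta> + ?R) * (\<theta> ^ Suc a + \<theta> ^ Suc b)"
    unfolding distrib_left distrib_right power_Suc R by simp
  then show ?thesis
    unfolding cycle_weight_def mm b by (simp add: a add_divide_distrib[symmetric])
qed

text \<open>Away from position 0 the cycle gives \<open>\<theta>\<close> + 1 /
  \<open>\<theta>\<close> and the k - 2 flips give \<open>\<theta>\<close> each, in total 2 sqrt (k
  - 1). At position 0 the factor 1 / \<open>\<theta>\<close> comes from the flip towards the root,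
  and the two cycle neighbours exceed 2 \<open>\<theta>\<close> by at most the second term of
  \<open>rate\<close>.\<close>

lemma weight_super:
  assumes "x \<in> vertices"
  shows "(\<Sum>t\<in>moves. weight (t x)) \<le> rate * weight x"
proof -
  let ?R = "sqrt (real k - 1)"
  obtain p H where x: "x = (p, H)" by (cases x)
  have p: "p < m" and H: "admissible H" using assms by (auto simp: x vertices_def)
  define W where "W = weight x"
  have W: "W = cycle_weight p * history_weight H" "W > 0"
    using cycle_weight_pos history_weight_pos by (simp_all add: W_def weight_def x)
  have rate: "2 * ?R * W \<le> rate * W"
    using W \<theta> by (intro mult_right_mono) (auto simp: rate_def)
  have up: "weight (flip j x) = \<theta> * W" if "\<not> (p = 0 \<and> H \<noteq> [] \<and> fst (hd H) = j)" for j
  proof -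
    have "flip j x = (0, (j, p) # H)" using that assms by (auto simp: x flip_def)
    then show ?thesis by (simp add: weight_def W cycle_weight_0)
  qed
  have k2: "real (k - 2) = real k - 2" using k by simp
  show ?thesis
  proof (cases "p = 0")
    case False
    have "weight (rot x) = cycle_weight (Suc p) * history_weight H"
      using assms by (simp add: rot_def x weight_def cycle_weight_0 cycle_weight_m)
    moreover have "weight (rot_inv x) = cycle_weight (p - 1) * history_weight H"
      using assms False by (simp add: rot_inv_def x weight_def)
    moreover have "(\<Sum>j<k - 2. weight (flip j x)) = (real k - 2) * (\<theta> * W)"
      using up False k2 by simp
    ultimately have "(\<Sum>t\<in>moves. weight (t x))
        = (cycle_weight (p - 1) + cycle_weight (Suc p)) * history_weight H + (real k - 2) * (\<theta> * W)"
      unfolding sum_moves by (simp add: algebra_simps)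
    also have "\<dots> = (?R + (real k - 1) * \<theta>) * W"
      using cycle_weight_rec[of p] False p W by (simp add: algebra_simps)
    also have "\<dots> = 2 * ?R * W" unfolding \<theta>(4) by simp
    finally show ?thesis using rate by (simp add: W_def)
  next
    case True
    have hW: "W = history_weight H" using W True by (simp add: cycle_weight_0)
    have "weight (rot x) + weight (rot_inv x) = 2 * cycle_weight 1 * W"
      using assms m True by (simp add: rot_def rot_inv_def x weight_def hW cycle_weight_last)
        (use cycle_weight_last in simp)
    also have "\<dots> \<le> 2 * (\<theta> + \<theta> ^ (m - 1)) * W"
      using cycle_weight_1 W by (intro mult_right_mono mult_left_mono) auto
    finally have rots: "weight (rot x) + weight (rot_inv x) \<le> 2 * (\<theta> + \<theta> ^ (m - 1)) * W" .
    have flips: "(\<Sum>j<k - 2. weight (flip j x)) \<le> (?R + (real k - 3) * \<theta>) * W"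
    proof (cases H)
      \<comment> \<open>On the root cycle no flip leads back; the missing factor 1 /
        \<open>\<theta>\<close> is replaced by the smaller \<open>\<theta>\<close>.\<close>
      case Nil
      have "1 \<le> ?R" using k by simp
      then have "\<theta> \<le> ?R" using \<theta>(2) by linarith
      have "(\<Sum>j<k - 2. weight (flip j x)) = (real k - 2) * \<theta> * W"
        using up Nil k2 by simp
      also have "\<dots> \<le> (?R + (real k - 3) * \<theta>) * W"
        using \<open>\<theta> \<le> ?R\<close> W by (intro mult_right_mono) (auto simp: algebra_simps)
      finally show ?thesis .
    next
      case (Cons e H')
      obtain i p' where e: "e = (i, p')" by (cases e)
      have i: "i < k - 2" using H by (simp add: Cons e)
      have "?R * W = \<theta> * ?R * (cycle_weight p' * history_weight H')" by (simp add: hW Cons e)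
      then have parent: "weight (flip i x) = ?R * W"
        using assms True unfolding \<theta>(3) by (simp add: x flip_def Cons e weight_def)
      have "(\<Sum>j<k - 2. weight (flip j x)) = ?R * W + (\<Sum>j\<in>{..<k - 2} - {i}. weight (flip j x))"
        using i parent by (subst sum.remove[of _ i]) auto
      also have "(\<Sum>j\<in>{..<k - 2} - {i}. weight (flip j x)) = (\<Sum>j\<in>{..<k - 2} - {i}. \<theta> * W)"
        using up Cons e by (intro sum.cong) auto
      also have "\<dots> = (real k - 3) * (\<theta> * W)"
        using i k by (simp add: card_Diff_singleton of_nat_diff)
      finally show ?thesis by (simp add: algebra_simps)
    qed
    have "(\<Sum>t\<in>moves. weight (t x)) \<le> 2 * (\<theta> + \<theta> ^ (m - 1)) * W + (?R + (real k - 3) * \<theta>) * W"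
      unfolding sum_moves using rots flips by linarith
    also have "\<dots> = (?R + (real k - 1) * \<theta> + 2 * \<theta> ^ (m - 1)) * W" by (simp add: algebra_simps)
    also have "\<dots> = rate * W" unfolding \<theta>(4) rate_def by simp
    finally show ?thesis by (simp add: W_def)
  qed
qed

lemma spectral_radius_le: "spectral_radius (perm_group moves) moves \<le> alpha k + 2 / real k * \<theta> ^ (m - 1)"
proof -
  have "T.growth \<le> rate"
  proof (rule T.growth_le_supersolution[where V = vertices and h = weight and \<alpha> = "\<lambda>t. t" and ?x0.0 = root])
    show "0 \<le> rate" using \<theta> k by (simp add: rate_def)
    show "card moves > 0" using card_moves k by simp
    show "s x \<in> vertices" if "s \<in> moves" "x \<in> vertices" for s x
      using that(1) rot_vertices[OF that(2)] rot_inv_vertices[OF that(2)] flip_vertices[OF _ that(2)]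
      unfolding moves_def by blast
    show "weight x > 0" for x by (simp add: weight_def cycle_weight_pos history_weight_pos)
    fix w assume w: "word_val (perm_group moves) w = \<one>\<^bsub>perm_group moves\<^esub>"
    have "word_val (perm_group moves) w x = foldr (\<lambda>t. t) w x" for x by (induction w) auto
    then show "foldr (\<lambda>t. t) w root = root" unfolding w by simp
  qed (use root weight_super in auto)
  then show ?thesis using k by (simp add: T.growth_def card_moves rate_def alpha_def field_simps)
qed

end

section \<open>No isolated points\<close>

theorem theorem1p2:
  fixes k :: nat
  assumes "k \<ge> 3"
  shows "\<forall>x \<in> {alpha k..1}. \<not> x isolated_in X_rho k"
proof
  fix x assume x: "x \<in> {alpha k..1}"
  have key: "\<exists>y\<in>X_rho k. y \<noteq> x \<and> \<bar>y - x\<bar> < \<epsilon>" if X: "x \<in> X_rho k" and \<epsilon>: "\<epsilon> > 0" for \<epsilon>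
  proof -
    obtain G :: "nat monoid" and S where GS: "group G" "symmetric_generating_set G S" "card S = k"
      and \<rho>: "x = spectral_radius G S" using X by (auto simp: X_rho_def)
    interpret marked_group G S
      using GS by (simp add: marked_group_def marked_group_axioms_def)
    show ?thesis
    proof (cases "finite (carrier G)")
      case True
      have "word_val G ` {w. set w \<subseteq> S \<and> length w = n} \<subseteq> carrier G" for n
        using word_closed by auto
      then have "real (card (word_val G ` {w. set w \<subseteq> S \<and> length w = n})) \<le> 0 * real n + real (card (carrier G))" for n
        using True by (simp add: card_mono)
      then have "x = 1"
        unfolding \<rho> using GS(3) assms
        by (intro spectral_radius_eq_1[of 0 "real (card (carrier G))"]) auto
      moreover obtain y where "y \<in> X_rho k" "1 - \<epsilon> < y" "y < 1"
        using exists_spectral_radius_below_1[OF assms \<epsilon>] by blast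
      ultimately show ?thesis by (intro bexI[of _ y]) auto
    next
      case inf: False
      show ?thesis
      proof (cases "\<exists>w. reduced w \<and> w \<noteq> [] \<and> word_val G w = \<one>\<^bsub>G\<^esub>")
        case True
        then obtain y where "y \<in> X_rho k" "x - \<epsilon> < y" "y < x"
          using exists_spectral_radius_slightly_below[OF inf _ _ _ \<epsilon>] GS(3) \<rho> by blast
        then show ?thesis by (intro bexI[of _ y]) auto
      next
        case False
        \<comment> \<open>A copy of the constant of \<open>cycle_tree\<close>, needed before that
          locale is available because \<open>m\<close> is chosen in terms of it.\<close>
        define \<theta> where "\<theta> = 1 / sqrt (real k - 1)"
        have \<theta>: "0 \<le> \<theta>" "\<theta> < 1" using assms by (auto simp: \<theta>_def)
        have "(\<lambda>m. 2 / real k * \<theta> ^ (m - 1)) \<longlonglongrightarrow> 2 / real k * 0"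
        proof (rule tendsto_mult_left, rule LIMSEQ_offset[of _ 1])
          show "(\<lambda>m. \<theta> ^ (m + 1 - 1)) \<longlonglongrightarrow> 0" using \<theta> by (simp add: LIMSEQ_power_zero)
        qed
        then have "eventually (\<lambda>m. 2 / real k * \<theta> ^ (m - 1) < \<epsilon>) sequentially"
          using \<epsilon> by (intro order_tendstoD(2)) auto
        then obtain M where M: "\<And>m. m \<ge> M \<Longrightarrow> 2 / real k * \<theta> ^ (m - 1) < \<epsilon>"
          unfolding eventually_sequentially by blast
        define m where "m = max M 3"
        interpret C: cycle_tree k m using assms by unfold_locales (auto simp: m_def)
        let ?y = "spectral_radius (perm_group C.moves) C.moves"
        have "growth \<le> C.T.growth"
        proof (subst growth_le_iff)
          show "\<forall>n. real (card (identity_words G S n)) \<le> C.T.growth ^ n"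
          proof
            fix n
            have "card (identity_words G S n) = cancel_count k n 0"
              using cancel_count_eq[of n] False GS(3) by blast
            also have "\<dots> \<le> card (identity_words (perm_group C.moves) C.moves n)"
              using C.T.cancel_count_le[of n] C.card_moves by simp
            finally show "real (card (identity_words G S n)) \<le> C.T.growth ^ n"
              using C.T.identity_words_le_growth[of n] C.card_moves assms by linarith
          qed
        qed (use C.T.growth_nonneg GS(3) assms in auto)
        then have "x \<le> ?y"
          using assms by (simp add: growth_def C.T.growth_def C.card_moves GS(3) \<rho>)
        \<comment> \<open>Here \<open>alpha k\<close> \<le> x enters: \<open>?y\<close> exceeds
          \<open>alpha k\<close> by less than \<open>\<epsilon>\<close>.\<close>
        moreover have "?y < x + \<epsilon>"
          using C.spectral_radius_le M[of m] x by (auto simp: m_def C.\<theta>_def \<theta>_def)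
        moreover have yX: "?y \<in> X_rho k" using C.T.spectral_radius_mem C.card_moves by simp
        ultimately show ?thesis
        proof (cases "?y = x")
          \<comment> \<open>The free product has the same radius as the tree, but its Cayley graph
            contains a cycle, so it can be approximated strictly from below.\<close>
          case True
          obtain y where "y \<in> X_rho k" "?y - \<epsilon> < y" "y < ?y"
            using C.reduced_loop C.T.exists_spectral_radius_slightly_below[OF C.infinite_carrier _ _ _ \<epsilon>]
            unfolding C.card_moves by blast
          then show ?thesis using True by (intro bexI[of _ y]) auto
        next
          case False
          then show ?thesis using \<open>x \<le> ?y\<close> \<open>?y < x + \<epsilon>\<close> yX by (intro bexI[of _ ?y]) auto
        qed
      qed
    qed
  qed
  show "\<not> x isolated_in X_rho k"
  proof
    assume "x isolated_in X_rho k"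
    then obtain U where U: "x \<in> X_rho k" "open U" "U \<inter> X_rho k = {x}"
      by (auto simp: isolated_in_def)
    then have "x \<in> U" by blast
    then obtain \<epsilon> where \<epsilon>: "\<epsilon> > 0" "\<And>y. dist y x < \<epsilon> \<Longrightarrow> y \<in> U"
      using U(2) unfolding open_dist by blast
    obtain y where "y \<in> X_rho k" "y \<noteq> x" "\<bar>y - x\<bar> < \<epsilon>" using key[OF U(1) \<epsilon>(1)] by blast
    then show False using U(3) \<epsilon>(2)[of y] by (auto simp: dist_real_def)
  qed
qed

end
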